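(* Let $G=(V,E,W_E)$ be a connected weighted graph. Then there exists an injective function $\varphi:\mathbf{bcd}_1(d_{\text{weight}})\rightarrow \mathbf{bcd}_1(d_{\text{edge}})$ of the form $\varphi([\beta,\delta])=[\beta,\delta']$ with $\delta\le\delta'$ for every $[\beta,\delta]\in\mathbf{bcd}_1(d_{\text{weight}})$.
   Context: A weighted graph $G=(V,E,W_E)$ is a finite simple undirected graph with a function $W_E:E\to\mathbb{R}^{>0}$. For a path $p$, $E(p)$ denotes its set of edges. Distances: for distinct $v,w\in V$, $d_{\text{weight}}(v,w)=\min_p\{\sum_{e\in E(p)}W_E(e)\mid p \text{ is a path from } v \text{ to } w\}$, and $d_{\text{edge}}(v,w)=\min_p\{\sum_{e\in E(p)}W_E(e)\mid p\text{ is a path from } v \text{ to } w \text{ with } |E(p)|=m_{vw}\}$, where $m_{vw}$ is the minimum number of edges among all paths from $v$ to $w$. Both are $0$ when $v=w$. Barcode: for a distance $d$ on $V$, let $\mathbb{X}$ be the full simplicial complex on $V$ (all nonempty subsets of $V$), and let $f:\mathbb{X}\to\mathbb{R}$ be $f(\sigma)=\max\{d(v,w)\mid v,w\in\sigma\}$ if $\dim\sigma\ge1$ and $f(\sigma)=0$ if $\sigma$ is a vertex. The sublevel complexes $\mathbb{X}_t=f^{-1}((-\infty,t])$ form the Vietoris--Rips filtration. $\mathbf{bcd}_k(d)$ is its $k$-dimensional persistence barcode with coefficients in $\mathbb{Z}/2\mathbb{Z}$: the multiset of intervals $[\beta,\delta]$ (birth, death) with $\beta<\delta$ (zero-length intervals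 are not included). Functions between barcodes are functions between multisets, i.e. elements are counted with multiplicity and injectivity is understood for elements counted with multiplicity. *)

theory Defs
  imports
    "HOL-Algebra.Product_Groups"
    "HOL-Library.Extended_Real"
    "HOL-Library.Multiset"
    "HOL-Library.Poly_Mapping"
    "HOL-Library.Z2"
begin

section \<open>Weighted graphs and the two distances\<close>

definition weighted_graph :: "'a set \<Rightarrow> 'a set set \<Rightarrow> ('a set \<Rightarrow> real) \<Rightarrow> bool" where
  "weighted_graph V E W \<longleftrightarrow>
     finite V \<and> (\<forall>e\<in>E. e \<subseteq> V \<and> card e = 2) \<and> (\<forall>e\<in>E. 0 < W e)"

fun path_edges :: "'a list \<Rightarrow> 'a set set" where
  "path_edges (x # y # p) = insert {x, y} (path_edges (y # p))"
| "path_edges _ = {}"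

text \<open>A path is given by its list of pairwise distinct vertices.\<close>

definition is_path :: "'a set \<Rightarrow> 'a set set \<Rightarrow> 'a \<Rightarrow> 'a \<Rightarrow> 'a list \<Rightarrow> bool" where
  "is_path V E v w p \<longleftrightarrow>
     p \<noteq> [] \<and> hd p = v \<and> last p = w \<and> distinct p \<and> set p \<subseteq> V \<and> path_edges p \<subseteq> E"

definition connected_graph :: "'a set \<Rightarrow> 'a set set \<Rightarrow> bool" where
  "connected_graph V E \<longleftrightarrow> (\<forall>v\<in>V. \<forall>w\<in>V. \<exists>p. is_path V E v w p)"

definition path_weight :: "('a set \<Rightarrow> real) \<Rightarrow> 'a list \<Rightarrow> real" where
  "path_weight W p = (\<Sum>e\<in>path_edges p. W e)"

definition d_weight :: "'a set \<Rightarrow> 'a set set \<Rightarrow> ('a set \<Rightarrow> real) \<Rightarrow> 'a \<Rightarrow> 'a \<Rightarrow> real" where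
  "d_weight V E W v w =
     (if v = w then 0 else Min {path_weight W p | p. is_path V E v w p})"

definition min_edge_count :: "'a set \<Rightarrow> 'a set set \<Rightarrow> 'a \<Rightarrow> 'a \<Rightarrow> nat" where
  "min_edge_count V E v w = Min {card (path_edges p) | p. is_path V E v w p}"

definition d_edge :: "'a set \<Rightarrow> 'a set set \<Rightarrow> ('a set \<Rightarrow> real) \<Rightarrow> 'a \<Rightarrow> 'a \<Rightarrow> real" where
  "d_edge V E W v w =
     (if v = w then 0
      else Min {path_weight W p | p.
                  is_path V E v w p \<and> card (path_edges p) = min_edge_count V E v w})"


section \<open>Simplicial homology with coefficients in Z/2\<close>

text \<open>
  A simplicial complex is the set of its (nonempty, finite) simplices. Chains are formal
  sums of simplices over the two-element field \<^typ>\<open>bit\<close>. Over this field linear maps are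
  the same as additive maps, so homology is treated as a quotient of abelian groups.
\<close>

definition chain_group :: "nat \<Rightarrow> 'a set set \<Rightarrow> ('a set \<Rightarrow>\<^sub>0 bit) monoid" where
  "chain_group k K =
     \<lparr>carrier = {c. Poly_Mapping.keys c \<subseteq> {\<sigma> \<in> K. card \<sigma> = Suc k}},
      monoid.mult = (+), one = 0\<rparr>"

text \<open>Vertices have boundary 0: the homology is not reduced.\<close>

definition boundary :: "('a set \<Rightarrow>\<^sub>0 bit) \<Rightarrow> ('a set \<Rightarrow>\<^sub>0 bit)" where
  "boundary c =
     (\<Sum>\<sigma> \<in> {\<sigma> \<in> Poly_Mapping.keys c. 2 \<le> card \<sigma>}. \<Sum>v\<in>\<sigma>. Poly_Mapping.single (\<sigma> - {v}) 1)"

definition cycles :: "nat \<Rightarrow> 'a set set \<Rightarrow> ('a set \<Rightarrow>\<^sub>0 bit) set" where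
  "cycles k K = {c \<in> carrier (chain_group k K). boundary c = 0}"

definition boundaries :: "nat \<Rightarrow> 'a set set \<Rightarrow> ('a set \<Rightarrow>\<^sub>0 bit) set" where
  "boundaries k K = boundary ` carrier (chain_group (Suc k) K)"

definition cycle_group :: "nat \<Rightarrow> 'a set set \<Rightarrow> ('a set \<Rightarrow>\<^sub>0 bit) monoid" where
  "cycle_group k K = (chain_group k K)\<lparr>carrier := cycles k K\<rparr>"

definition homology :: "nat \<Rightarrow> 'a set set \<Rightarrow> ('a set \<Rightarrow>\<^sub>0 bit) set monoid" where
  "homology k K = cycle_group k K Mod boundaries k K"

text \<open>
  The map on homology induced by the inclusion of a subcomplex of \<open>L\<close>. A class is a coset
  \<open>c + boundaries k K\<close>, and adding all of \<open>boundaries k L\<close> gives the coset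
  \<open>c + boundaries k L\<close>.
\<close>

definition homology_inclusion ::
    "nat \<Rightarrow> 'a set set \<Rightarrow> ('a set \<Rightarrow>\<^sub>0 bit) set \<Rightarrow> ('a set \<Rightarrow>\<^sub>0 bit) set" where
  "homology_inclusion k L x = boundaries k L <#>\<^bsub>cycle_group k L\<^esub> x"


section \<open>Persistence modules over Z/2 and barcodes\<close>

text \<open>
  A persistence module is given by a vector space over Z/2 (as a group) for every real
  parameter and by structure maps for all \<open>s \<le> t\<close>.
\<close>

definition pers_iso ::
    "(real \<Rightarrow> 'x monoid) \<Rightarrow> (real \<Rightarrow> real \<Rightarrow> 'x \<Rightarrow> 'x) \<Rightarrow>
     (real \<Rightarrow> 'y monoid) \<Rightarrow> (real \<Rightarrow> real \<Rightarrow> 'y \<Rightarrow> 'y) \<Rightarrow> bool" where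
  "pers_iso M p N q \<longleftrightarrow>
     (\<exists>\<phi>. (\<forall>t. \<phi> t \<in> iso (M t) (N t)) \<and>
          (\<forall>s t. s \<le> t \<longrightarrow> (\<forall>x \<in> carrier (M s). \<phi> t (p s t x) = q s t (\<phi> s x))))"

text \<open>
  The bar with birth \<open>\<beta>\<close> and death \<open>\<delta>\<close> is the pair \<open>(\<beta>, \<delta>)\<close>; its death is \<open>\<infinity>\<close> if it never
  dies. Sublevel filtrations are right-continuous, so a class is alive exactly for
  \<open>\<beta> \<le> t < \<delta>\<close>.
\<close>

type_synonym bar = "real \<times> ereal"

definition alive :: "bar \<Rightarrow> real \<Rightarrow> bool" where
  "alive I t \<longleftrightarrow> fst I \<le> t \<and> ereal t < snd I"

definition interval_module :: "bar \<Rightarrow> real \<Rightarrow> bit monoid" where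
  "interval_module I t =
     \<lparr>carrier = (if alive I t then UNIV else {0}), monoid.mult = (+), one = 0\<rparr>"

definition interval_map :: "bar \<Rightarrow> real \<Rightarrow> real \<Rightarrow> bit \<Rightarrow> bit" where
  "interval_map I s t x = (if alive I s \<and> alive I t then x else 0)"

text \<open>The elements of a multiset counted with multiplicity: the copies of \<open>x\<close> are \<open>(x, i)\<close>.\<close>

definition mset_elems :: "'b multiset \<Rightarrow> ('b \<times> nat) set" where
  "mset_elems B = {(x, i). i < count B x}"

definition bars_module :: "bar multiset \<Rightarrow> real \<Rightarrow> (bar \<times> nat \<Rightarrow> bit) monoid" where
  "bars_module B t = sum_group (mset_elems B) (\<lambda>j. interval_module (fst j) t)"

definition bars_map ::
    "bar multiset \<Rightarrow> real \<Rightarrow> real \<Rightarrow> (bar \<times> nat \<Rightarrow> bit) \<Rightarrow> (bar \<times> nat \<Rightarrow> bit)" where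
  "bars_map B s t x = (\<lambda>j\<in>mset_elems B. interval_map (fst j) s t (x j))"

text \<open>
  The barcode of a persistence module: the unique multiset of nonempty intervals such that
  the module is isomorphic to the direct sum of the corresponding interval modules.
\<close>

definition barcode ::
    "(real \<Rightarrow> 'x monoid) \<Rightarrow> (real \<Rightarrow> real \<Rightarrow> 'x \<Rightarrow> 'x) \<Rightarrow> bar multiset" where
  "barcode M p =
     (THE B. (\<forall>I \<in># B. ereal (fst I) < snd I) \<and>
             pers_iso M p (bars_module B) (bars_map B))"


section \<open>The Vietoris-Rips filtration\<close>

definition full_complex :: "'a set \<Rightarrow> 'a set set" where
  "full_complex V = {\<sigma>. \<sigma> \<subseteq> V \<and> \<sigma> \<noteq> {}}"

definition rips_value :: "('a \<Rightarrow> 'a \<Rightarrow> real) \<Rightarrow> 'a set \<Rightarrow> real" where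
  "rips_value d \<sigma> = (if card \<sigma> = 1 then 0 else Max {d v w | v w. v \<in> \<sigma> \<and> w \<in> \<sigma>})"

definition rips :: "'a set \<Rightarrow> ('a \<Rightarrow> 'a \<Rightarrow> real) \<Rightarrow> real \<Rightarrow> 'a set set" where
  "rips V d t = {\<sigma> \<in> full_complex V. rips_value d \<sigma> \<le> t}"

definition bcd :: "nat \<Rightarrow> 'a set \<Rightarrow> ('a \<Rightarrow> 'a \<Rightarrow> real) \<Rightarrow> bar multiset" where
  "bcd k V d =
     barcode (\<lambda>t. homology k (rips V d t)) (\<lambda>s t. homology_inclusion k (rips V d t))"

end

theory Submission
  imports Defs
begin

text \<open>
  For every \<open>t\<close> the Rips complex of \<open>d_edge\<close> is contained in that of \<open>d_weight\<close>, and the induced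
  map on first homology is onto: two vertices at weighted distance at most \<open>t\<close> are joined by a
  path of weight at most \<open>t\<close>, whose edges already lie in the Rips complex of \<open>d_edge\<close>, and the
  cone over this path fills the loop in the Rips complex of \<open>d_weight\<close>.

  Both persistence modules therefore are quotients of one filtered space of cycles, by a smaller
  and a larger filtration of boundaries. Counting cosets shows that, among the bars born at
  \<open>\<beta>\<close>, the smaller quotient has at most as many dying at or after \<open>\<delta>\<close> as the larger one,
  for every \<open>\<delta>\<close>, and such families of bars can be matched injectively. Barcodes exist
  because two chains of subspaces of a finite vector space have a common adapted basis; they are
  unique because the ranks of the structure maps count bars.
\<close>

section \<open>Boolean groups and bases adapted to two filtrations\<close>

text \<open>An abelian group of exponent 2 carries exactly one structure of a vector space over Z/2.
  Chains with coefficients in \<open>bit\<close> are of this kind.\<close>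

class boolean_group = ab_group_add +
  assumes add_self: "x + x = 0"
begin

lemma uminus_boolean [simp]: "- x = x"
  by (metis add_self add.inverse_unique)

lemma diff_boolean [simp]: "x - y = x + y"
  by (metis uminus_boolean add_uminus_conv_diff)

end

instance bit :: boolean_group
  by standard simp

instance poly_mapping :: (type, boolean_group) boolean_group
  by standard (simp add: poly_mapping_eqI lookup_add add_self)

definition scale2 :: "bit \<Rightarrow> 'c::boolean_group \<Rightarrow> 'c" where
  "scale2 b x = (if b = 0 then 0 else x)"

global_interpretation F2: vector_space "scale2 :: bit \<Rightarrow> 'c::boolean_group \<Rightarrow> 'c"
proof
  fix a b :: bit and x y :: 'c
  show "scale2 (a + b) x = scale2 a x + scale2 b x"
    by (cases a; cases b) (simp_all add: scale2_def add_self)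
qed (simp_all add: scale2_def)

lemma subspace_iff:
  "F2.subspace A \<longleftrightarrow> 0 \<in> A \<and> (\<forall>x\<in>A. \<forall>y\<in>A. x + y \<in> A)"
  by (auto simp: F2.subspace_def scale2_def)

text \<open>For independent \<open>S\<close> and subspaces \<open>X\<close> the condition says that
  \<open>S \<inter> X\<close> is a basis of \<open>X\<close>.\<close>

definition adapted :: "'c::boolean_group set \<Rightarrow> 'c set set \<Rightarrow> bool" where
  "adapted S \<A> \<longleftrightarrow> (\<forall>X\<in>\<A>. X \<subseteq> F2.span (S \<inter> X))"

lemma sum_representation:
  assumes "F2.independent S" "x \<in> F2.span S"
  shows "(\<Sum>e | F2.representation S x e \<noteq> 0. e) = x"
proof -
  have "(\<Sum>e | F2.representation S x e \<noteq> 0. e)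
      = (\<Sum>e | F2.representation S x e \<noteq> 0. scale2 (F2.representation S x e) e)"
    by (rule sum.cong) (auto simp: scale2_def)
  then show ?thesis
    using F2.sum_nonzero_representation_eq[OF assms] by simp
qed

text \<open>
  Exchange argument: among the independent sets adapted to \<open>\<U>\<close>, take one whose elements are
  missing from as few members of \<open>\<W>\<close> as possible. If a vector of \<open>X \<in> \<W>\<close> were not spanned inside
  \<open>X\<close>, it could replace the basis element in its expansion that enters \<open>\<U>\<close> last.
\<close>

lemma adapted_basis_refine:
  fixes C :: "'c::boolean_group set"
  assumes fin: "finite C" "finite \<U>" "finite \<W>"
    and sub: "\<And>X. X \<in> \<U> \<union> \<W> \<Longrightarrow> F2.subspace X"
    and chU: "\<And>X Y. X \<in> \<U> \<Longrightarrow> Y \<in> \<U> \<Longrightarrow> X \<subseteq> Y \<or> Y \<subseteq> X"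
    and chW: "\<And>X Y. X \<in> \<W> \<Longrightarrow> Y \<in> \<W> \<Longrightarrow> X \<subseteq> Y \<or> Y \<subseteq> X"
    and C: "C \<in> \<U>" "\<And>X. X \<in> \<W> \<Longrightarrow> X \<subseteq> C"
    and R: "R \<subseteq> C" "F2.independent R" "adapted R \<U>"
  shows "\<exists>S\<subseteq>C. F2.independent S \<and> adapted S \<U> \<and> adapted S \<W>"
proof -
  define P where "P = (\<lambda>S. S \<subseteq> C \<and> F2.independent S \<and> adapted S \<U>)"
  define \<mu> where "\<mu> = (\<lambda>S. \<Sum>e\<in>S. card {X \<in> \<W>. e \<notin> X})"
  have "P R" using R by (simp add: P_def)
  from ex_has_least_nat[of P R \<mu>, OF this] obtain S where
    PS: "P S" and least: "\<And>S'. P S' \<Longrightarrow> \<mu> S \<le> \<mu> S'" by blast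
  have S: "S \<subseteq> C" "F2.independent S" "adapted S \<U>" "finite S"
    using PS fin(1) by (auto simp: P_def intro: finite_subset)
  have "adapted S \<W>"
  proof (rule ccontr)
    assume "\<not> adapted S \<W>"
    then obtain X x where X: "X \<in> \<W>" and x: "x \<in> X" "x \<notin> F2.span (S \<inter> X)"
      by (auto simp: adapted_def)
    have "x \<in> F2.span (S \<inter> C)"
      using S(3) C x X by (auto simp: adapted_def)
    then have "x \<in> F2.span (S \<inter> X \<union> (S - X))"
      using F2.span_mono[of "S \<inter> C" "S \<inter> X \<union> (S - X)"] by auto
    then obtain a y where ay: "x = a + y" "a \<in> F2.span (S \<inter> X)" "y \<in> F2.span (S - X)"
      by (auto simp: F2.span_Un)
    have spX: "F2.subspace X" using sub X by blast
    have "a \<in> X"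
      using ay(2) F2.span_minimal[OF _ spX, of "S \<inter> X"] by blast
    moreover have y_eq: "y = a + x"
      using ay(1) by (simp add: add.assoc[symmetric] add_self)
    ultimately have yX: "y \<in> X" using x spX by (auto simp: F2.subspace_add)
    have "y \<noteq> 0" using ay x by auto
    define T where "T = {e. F2.representation S y e \<noteq> 0}"
    have yS: "y \<in> F2.span S" using ay(3) F2.span_mono[of "S - X" S] by blast
    have sumT: "\<Sum>T = y"
      using sum_representation[OF S(2) yS] by (simp add: T_def)
    have "F2.representation S y = F2.representation (S - X) y"
      by (rule F2.representation_extend[OF S(2) ay(3)]) auto
    then have T: "T \<subseteq> S - X"
      using F2.representation_ne_zero by (auto simp: T_def)
    have finT: "finite T" using T S(4) by (auto intro: finite_subset)
    have "T \<noteq> {}" using sumT \<open>y \<noteq> 0\<close> by auto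
    \<comment> \<open>Lying in the fewest members of the chain \<open>\<U>\<close> means entering it
      last: every \<open>Y \<in> \<U>\<close> that contains \<open>e\<close> contains all of
      \<open>T\<close>.\<close>
    then obtain e where e: "e \<in> T"
      and emin: "\<And>f. f \<in> T \<Longrightarrow> card {Y \<in> \<U>. e \<in> Y} \<le> card {Y \<in> \<U>. f \<in> Y}"
      using ex_has_least_nat[of "\<lambda>e. e \<in> T" _ "\<lambda>e. card {Y \<in> \<U>. e \<in> Y}"] by blast
    have TY: "T \<subseteq> Y" if Y: "Y \<in> \<U>" "e \<in> Y" for Y
    proof
      fix f assume f: "f \<in> T"
      show "f \<in> Y"
      proof (rule ccontr)
        assume "f \<notin> Y"
        then have "{Y \<in> \<U>. f \<in> Y} \<subset> {Y \<in> \<U>. e \<in> Y}"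
          using chU Y by blast
        then have "card {Y \<in> \<U>. f \<in> Y} < card {Y \<in> \<U>. e \<in> Y}"
          using fin(2) by (intro psubset_card_mono) auto
        with emin[OF f] show False by simp
      qed
    qed
    define S' where "S' = insert y (S - {e})"
    have eS: "e \<in> S" "e \<notin> X" using e T by auto
    have yT: "y = e + \<Sum>(T - {e})"
      using sumT finT e by (simp add: sum.remove)
    then have e_eq: "e = y + \<Sum>(T - {e})"
      by (simp add: add.assoc add_self)
    \<comment> \<open>The exchange can be reversed. This yields both the independence of
      \<open>S'\<close> and its adaptedness to \<open>\<U>\<close>.\<close>
    have e_span: "e \<in> F2.span (insert y (T - {e}))"
    proof -
      have "\<Sum>(T - {e}) \<in> F2.span (insert y (T - {e}))"
        by (rule F2.span_sum) (auto intro: F2.span_base)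
      then have "y + \<Sum>(T - {e}) \<in> F2.span (insert y (T - {e}))"
        by (intro F2.span_add) (auto intro: F2.span_base)
      then show ?thesis using e_eq by simp
    qed
    have y_notin: "y \<notin> F2.span (S - {e})"
    proof
      assume "y \<in> F2.span (S - {e})"
      moreover have "T - {e} \<subseteq> F2.span (S - {e})"
        using T by (auto intro: F2.span_base)
      ultimately have "F2.span (insert y (T - {e})) \<subseteq> F2.span (S - {e})"
        by (intro F2.span_minimal F2.subspace_span) auto
      with e_span eS S(2) show False by (auto simp: F2.dependent_def)
    qed
    have "P S'"
      unfolding P_def
    proof (intro conjI)
      show "S' \<subseteq> C" using S(1) yX C X by (auto simp: S'_def)
      show "F2.independent S'"
        unfolding S'_def
        by (rule F2.independent_insertI[OF y_notin]) (rule F2.independent_mono[OF S(2)], blast)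
      show "adapted S' \<U>"
        unfolding adapted_def
      proof
        fix Y assume Y: "Y \<in> \<U>"
        have spY: "F2.subspace Y" using sub Y by blast
        have "S \<inter> Y \<subseteq> F2.span (S' \<inter> Y)"
        proof (cases "e \<in> Y")
          case False
          then show ?thesis by (auto simp: S'_def intro: F2.span_base)
        next
          case True
          then have "T \<subseteq> Y" using TY Y by blast
          then have "y \<in> Y" using sumT F2.subspace_sum[OF spY, of T "\<lambda>x. x"] by auto
          then have "insert y (T - {e}) \<subseteq> S' \<inter> Y"
            using T \<open>T \<subseteq> Y\<close> by (auto simp: S'_def)
          then have "e \<in> F2.span (S' \<inter> Y)"
            using e_span F2.span_mono by blast
          then show ?thesis by (auto simp: S'_def intro: F2.span_base)
        qed
        then have "F2.span (S \<inter> Y) \<subseteq> F2.span (S' \<inter> Y)"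
          by (intro F2.span_minimal F2.subspace_span)
        then show "Y \<subseteq> F2.span (S' \<inter> Y)"
          using S(3) Y by (auto simp: adapted_def)
      qed
    qed
    have "y \<notin> S - {e}" using y_notin F2.span_base[of y "S - {e}"] by auto
    then have \<mu>S': "\<mu> S' = card {Z \<in> \<W>. y \<notin> Z} + (\<Sum>f\<in>S - {e}. card {Z \<in> \<W>. f \<notin> Z})"
      using S(4) by (simp add: \<mu>_def S'_def)
    have \<mu>S: "\<mu> S = card {Z \<in> \<W>. e \<notin> Z} + (\<Sum>f\<in>S - {e}. card {Z \<in> \<W>. f \<notin> Z})"
      using S(4) eS by (simp add: \<mu>_def sum.remove)
    \<comment> \<open>If \<open>y \<notin> Z\<close>, then \<open>X\<close> is not contained in
      \<open>Z\<close>, so \<open>Z \<subseteq> X\<close> and \<open>e \<notin> Z\<close>. The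
      inclusion is strict because of \<open>X\<close> itself.\<close>
    have "{Z \<in> \<W>. y \<notin> Z} \<subset> {Z \<in> \<W>. e \<notin> Z}"
      using chW X yX eS by blast
    then have "card {Z \<in> \<W>. y \<notin> Z} < card {Z \<in> \<W>. e \<notin> Z}"
      using fin(3) by (intro psubset_card_mono) auto
    with \<mu>S \<mu>S' least[OF \<open>P S'\<close>] show False by simp
  qed
  with S show ?thesis by blast
qed

text \<open>Two refinements: a basis of \<open>C\<close>, trivially adapted to \<open>{C}\<close>,
  is refined to \<open>\<U>\<close>, and the result to \<open>\<W>\<close>. \<open>C\<close> is
  inserted into \<open>\<U>\<close> for the second round because the chain already served must
  contain it.\<close>

lemma adapted_basis_exists:
  fixes C :: "'c::boolean_group set"
  assumes fin: "finite C" and C: "F2.subspace C"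
    and sub: "\<And>X. X \<in> \<U> \<union> \<W> \<Longrightarrow> F2.subspace X \<and> X \<subseteq> C"
    and chU: "\<And>X Y. X \<in> \<U> \<Longrightarrow> Y \<in> \<U> \<Longrightarrow> X \<subseteq> Y \<or> Y \<subseteq> X"
    and chW: "\<And>X Y. X \<in> \<W> \<Longrightarrow> Y \<in> \<W> \<Longrightarrow> X \<subseteq> Y \<or> Y \<subseteq> X"
  obtains S where "S \<subseteq> C" "F2.independent S" "adapted S \<U>" "adapted S \<W>"
proof -
  have "\<U> \<subseteq> Pow C" "\<W> \<subseteq> Pow C" using sub by auto
  then have finUW: "finite \<U>" "finite \<W>" using fin by (auto intro: finite_subset)
  obtain R where R: "R \<subseteq> C" "F2.independent R" "C \<subseteq> F2.span R"
    by (rule F2.maximal_independent_subset)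
  then have "R \<inter> C = R" by blast
  then have ad: "adapted R {C}" using R by (simp add: adapted_def)
  have "\<exists>S\<subseteq>C. F2.independent S \<and> adapted S {C} \<and> adapted S \<U>"
  proof (rule adapted_basis_refine[of C "{C}" \<U> R])
    show "X \<subseteq> Y \<or> Y \<subseteq> X" if "X \<in> \<U>" "Y \<in> \<U>" for X Y
      using that chU by simp
  qed (use R finUW fin sub C ad in auto)
  then obtain R1 where R1: "R1 \<subseteq> C" "F2.independent R1" "adapted R1 (insert C \<U>)"
    by (auto simp: adapted_def)
  have "\<exists>S\<subseteq>C. F2.independent S \<and> adapted S (insert C \<U>) \<and> adapted S \<W>"
  proof (rule adapted_basis_refine[of C "insert C \<U>" \<W> R1])
    show "X \<subseteq> Y \<or> Y \<subseteq> X" if "X \<in> insert C \<U>" "Y \<in> insert C \<U>" for X Y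
      using that chU sub by blast
  qed (use R1 finUW fin sub chW C in auto)
  then show ?thesis using that by (auto simp: adapted_def)
qed

section \<open>Counting cosets and matching finite families\<close>

lemma card_eq_card_image_times_kernel:
  fixes A N :: "'c::ab_group_add set"
  assumes "finite A" "\<And>x y. x \<in> A \<Longrightarrow> y \<in> A \<Longrightarrow> x - y \<in> A \<and> x + y \<in> A"
    and f: "\<And>x y. x \<in> A \<Longrightarrow> y \<in> A \<Longrightarrow> f x = f y \<longleftrightarrow> x - y \<in> N"
  shows "card A = card (f ` A) * card (A \<inter> N)"
proof -
  \<comment> \<open>The fibre over \<open>f a\<close> is the translate of
    \<open>A \<inter> N\<close> by \<open>a\<close>, so all fibres have the same size.\<close>
  have "card {x \<in> A. f x = v} = card (A \<inter> N)" if "v \<in> f ` A" for v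
  proof -
    from that obtain a where a: "a \<in> A" "v = f a" by blast
    have "bij_betw (\<lambda>x. x - a) {x \<in> A. f x = v} (A \<inter> N)"
    proof (rule bij_betw_byWitness[where f' = "\<lambda>x. x + a"])
      show "(\<lambda>x. x + a) ` (A \<inter> N) \<subseteq> {x \<in> A. f x = v}"
        using a assms(2) by (auto simp: f)
    qed (use a assms(2) f in auto)
    then show ?thesis by (rule bij_betw_same_card)
  qed
  then have "(\<Sum>v\<in>f ` A. card {x \<in> A. f x = v}) = card (f ` A) * card (A \<inter> N)"
    by simp
  moreover have "card A = (\<Sum>v\<in>f ` A. card {x \<in> A. f x = v})"
    using sum.image_gen[OF \<open>finite A\<close>, of "\<lambda>_. 1::nat" f] by simp
  ultimately show ?thesis by simp
qed

lemma translate_eq_iff: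
  assumes A: "F2.subspace A"
  shows "(\<lambda>b. b + x) ` A = (\<lambda>b. b + y) ` A \<longleftrightarrow> x + y \<in> A"
proof
  assume eq: "(\<lambda>b. b + x) ` A = (\<lambda>b. b + y) ` A"
  have "0 + x \<in> (\<lambda>b. b + x) ` A" using A by (auto simp: subspace_iff)
  then obtain b where "b \<in> A" "x = b + y" using eq by auto
  then show "x + y \<in> A" by (simp add: add.assoc add_self)
next
  have *: "(\<lambda>b. b + x) ` A \<subseteq> (\<lambda>b. b + y) ` A" if "x + y \<in> A" for x y
  proof
    fix w assume "w \<in> (\<lambda>b. b + x) ` A"
    then obtain b where b: "b \<in> A" "w = b + x" by auto
    then have "b + (x + y) \<in> A" using that A by (auto simp: subspace_iff)
    moreover have "w = b + (x + y) + y" using b by (simp add: add.assoc add_self)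
    ultimately show "w \<in> (\<lambda>b. b + y) ` A" by blast
  qed
  assume "x + y \<in> A"
  then show "(\<lambda>b. b + x) ` A = (\<lambda>b. b + y) ` A"
    using *[of x y] *[of y x] by (simp add: add.commute)
qed

text \<open>Lagrange's theorem for the image of \<open>D\<close> in the quotient by
  \<open>A\<close>, where \<open>A\<close> may reach outside \<open>D\<close>. With a space of
  cycles for \<open>D\<close> and a later space of boundaries for \<open>A\<close> it computes the
  size of the image of a structure map.\<close>

lemma card_translates:
  assumes "F2.subspace A" "F2.subspace D" "finite D"
  shows "card D = card ((\<lambda>x. (\<lambda>b. b + x) ` A) ` D) * card (D \<inter> A)"
  using assms by (intro card_eq_card_image_times_kernel) (auto simp: translate_eq_iff subspace_iff)

text \<open>\<open>B / (A \<inter> B)\<close> embeds into \<open>D / A\<close>. This is the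
  inequality dim A + dim B \<le> dim D + dim (A \<inter> B) in multiplicative form.\<close>

lemma subspace_card_Int_le:
  fixes A B D :: "'c::boolean_group set"
  assumes A: "F2.subspace A" "finite A" and B: "F2.subspace B" "finite B"
    and D: "F2.subspace D" "finite D" "A \<subseteq> D" "B \<subseteq> D"
  shows "card A * card B \<le> card D * card (A \<inter> B)"
proof -
  let ?Q = "(\<lambda>x. (\<lambda>b. b + x) ` A)"
  have "card D = card (?Q ` D) * card A"
    using card_translates[OF A(1) D(1,2)] D(3) by (simp add: Int_absorb1)
  moreover have "card B = card (?Q ` B) * card (A \<inter> B)"
    using card_translates[OF A(1) B] by (simp add: Int_commute)
  moreover have "card (?Q ` B) \<le> card (?Q ` D)"
    using D by (intro card_mono) auto
  ultimately show ?thesis by simp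
qed

text \<open>Greedy matching by induction on the size. An element \<open>x\<close> of least value is
  matched last: the bound at level \<open>v x\<close> counts all of \<open>X\<close>, so at least
  \<open>card X\<close> elements of \<open>Y\<close> are admissible for \<open>x\<close>, and the
  other matches occupy fewer.\<close>

lemma dominated_matching:
  fixes v :: "'x \<Rightarrow> 'l::linorder" and w :: "'y \<Rightarrow> 'l"
  assumes "finite X" "finite Y"
    and "\<And>l. l \<in> v ` X \<Longrightarrow> card {x \<in> X. l \<le> v x} \<le> card {y \<in> Y. l \<le> w y}"
  shows "\<exists>f. inj_on f X \<and> f ` X \<subseteq> Y \<and> (\<forall>x\<in>X. v x \<le> w (f x))"
  using assms(1,3)
proof (induction "card X" arbitrary: X)
  case 0
  then show ?case by auto
next
  case (Suc n)
  then have "X \<noteq> {}" by auto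
  then obtain x where x: "x \<in> X" "\<And>z. z \<in> X \<Longrightarrow> v x \<le> v z"
    using Suc.prems(1) by (metis (no_types, lifting) arg_min_if_finite(1) arg_min_least)
  define X' where "X' = X - {x}"
  have "\<exists>f. inj_on f X' \<and> f ` X' \<subseteq> Y \<and> (\<forall>x\<in>X'. v x \<le> w (f x))"
  proof (rule Suc.hyps)
    fix l assume "l \<in> v ` X'"
    then have "card {x \<in> X. l \<le> v x} \<le> card {y \<in> Y. l \<le> w y}"
      using Suc.prems(2) by (auto simp: X'_def)
    moreover have "card {x \<in> X'. l \<le> v x} \<le> card {x \<in> X. l \<le> v x}"
      using Suc.prems(1) by (intro card_mono) (auto simp: X'_def)
    ultimately show "card {x \<in> X'. l \<le> v x} \<le> card {y \<in> Y. l \<le> w y}" by simp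
  qed (use Suc x in \<open>auto simp: X'_def\<close>)
  then obtain f where f: "inj_on f X'" "f ` X' \<subseteq> Y" "\<And>z. z \<in> X' \<Longrightarrow> v z \<le> w (f z)" by blast
  let ?Y = "{y \<in> Y. v x \<le> w y}"
  have "{z \<in> X. v x \<le> v z} = X" using x by auto
  then have "card X \<le> card ?Y" using Suc.prems(2) x(1) by force
  moreover have "card (f ` X') < card X"
    using card_image[OF f(1)] card_Diff1_less[OF Suc.prems(1) x(1)] by (simp add: X'_def)
  ultimately have "\<not> ?Y \<subseteq> f ` X'"
    using Suc.prems(1) card_mono[of "f ` X'" ?Y] by (auto simp: X'_def)
  then obtain y where y: "y \<in> ?Y" "y \<notin> f ` X'" by blast
  have "X = insert x X'" "x \<notin> X'" using x by (auto simp: X'_def)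
  then show ?case
    using f y by (intro exI[of _ "f(x := y)"]) (auto simp: inj_on_def)
qed

section \<open>Barcodes and ranks\<close>

lemma finite_mset_elems [simp]: "finite (mset_elems B)"
proof -
  have "mset_elems B = (SIGMA x:set_mset B. {..<count B x})"
    by (auto simp: mset_elems_def intro: count_inI)
  then show ?thesis by simp
qed

text \<open>Barcodes are built below as images of finite sets of basis vectors. The bijection lets
  an index, a bar with the number of its copy, stand for a basis vector.\<close>

lemma mset_elems_image_mset_bij:
  assumes "finite S"
  obtains g where "bij_betw g (mset_elems (image_mset f (mset_set S))) S"
    "\<And>j. j \<in> mset_elems (image_mset f (mset_set S)) \<Longrightarrow> f (g j) = fst j"
proof -
  have count: "count (image_mset f (mset_set S)) x = card {e \<in> S. f e = x}" for x
  proof -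
    have "count (image_mset f (mset_set S)) x = (\<Sum>e\<in>f -` {x} \<inter> S. count (mset_set S) e)"
      using assms by (simp add: count_image_mset)
    also have "\<dots> = card (f -` {x} \<inter> S)" using assms by simp
    also have "f -` {x} \<inter> S = {e \<in> S. f e = x}" by auto
    finally show ?thesis .
  qed
  \<comment> \<open>Number the elements of each fibre of \<open>f\<close>; the copy
    \<open>(x, i)\<close> goes to element number \<open>i\<close> of the fibre over
    \<open>x\<close>.\<close>
  have "\<exists>h. bij_betw h {0..<card {e \<in> S. f e = x}} {e \<in> S. f e = x}" for x
    using assms by (intro ex_bij_betw_nat_finite) auto
  then obtain h where h: "\<And>x. bij_betw (h x) {0..<card {e \<in> S. f e = x}} {e \<in> S. f e = x}"
    by metis
  let ?g = "\<lambda>j. h (fst j) (snd j)" and ?J = "mset_elems (image_mset f (mset_set S))"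
  have mem: "?g j \<in> S \<and> f (?g j) = fst j" if "j \<in> ?J" for j
  proof -
    have "snd j \<in> {0..<card {e \<in> S. f e = fst j}}"
      using that by (auto simp: mset_elems_def count)
    then have "?g j \<in> {e \<in> S. f e = fst j}" using h bij_betwE by blast
    then show ?thesis by simp
  qed
  have "bij_betw ?g ?J S"
  proof (rule bij_betw_imageI)
    show "inj_on ?g ?J"
    proof (rule inj_onI)
      fix j k assume jk: "j \<in> ?J" "k \<in> ?J" "?g j = ?g k"
      then have eq: "fst j = fst k" using mem by metis
      moreover have "snd j = snd k"
        using jk eq bij_betw_imp_inj_on[OF h[of "fst j"]]
        by (auto simp: mset_elems_def count inj_on_def)
      ultimately show "j = k" by (simp add: prod_eq_iff)
    qed
    show "?g ` ?J = S"
    proof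
      show "S \<subseteq> ?g ` ?J"
      proof
        fix e assume e: "e \<in> S"
        then have "e \<in> h (f e) ` {0..<card {e' \<in> S. f e' = f e}}"
          using h[of "f e"] by (auto simp: bij_betw_def)
        then obtain i where "i < card {e' \<in> S. f e' = f e}" "e = h (f e) i" by auto
        then show "e \<in> ?g ` ?J"
          by (intro image_eqI[of _ _ "(f e, i)"]) (auto simp: mset_elems_def count)
      qed
    qed (use mem in auto)
  qed
  then show ?thesis using mem that by blast
qed

section \<open>Ranks in sums of interval modules\<close>

lemma group_interval_module: "group (interval_module I t)"
  by (rule groupI) (auto simp: interval_module_def add.assoc intro: exI[of _ 0] split: if_splits)

lemma group_bars_module: "group (bars_module B t)"
  by (simp add: bars_module_def group_interval_module)

lemma carrier_bars_module:
  "carrier (bars_module B t) =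
    (\<Pi>\<^sub>E j\<in>mset_elems B. if alive (fst j) t then UNIV else {0})"
  unfolding bars_module_def
  by (subst carrier_sum_group) (simp_all add: group_interval_module, simp add: interval_module_def)

text \<open>For \<open>s \<le> t\<close> this is the rank of the structure map from \<open>s\<close>
  to \<open>t\<close>.\<close>

definition alive_count :: "bar multiset \<Rightarrow> real \<Rightarrow> real \<Rightarrow> nat" where
  "alive_count B s t = card {j \<in> mset_elems B. alive (fst j) s \<and> alive (fst j) t}"

text \<open>The image is a product with one factor Z/2 for each bar alive at both parameters and
  trivial factors for the other bars.\<close>

lemma card_image_bars_map:
  "card (bars_map B s t ` carrier (bars_module B s)) = 2 ^ alive_count B s t"
proof -
  let ?F = "\<lambda>j. if alive (fst j) s \<and> alive (fst j) t then UNIV :: bit set else {0}"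
  have "bars_map B s t ` carrier (bars_module B s) = PiE (mset_elems B) ?F"
  proof
    show "bars_map B s t ` carrier (bars_module B s) \<subseteq> PiE (mset_elems B) ?F"
      by (auto simp: bars_map_def interval_map_def PiE_iff)
    show "PiE (mset_elems B) ?F \<subseteq> bars_map B s t ` carrier (bars_module B s)"
    proof
      fix y assume y: "y \<in> PiE (mset_elems B) ?F"
      have "bars_map B s t y = y"
      proof
        fix j show "bars_map B s t y j = y j"
          using PiE_mem[OF y, of j] PiE_arb[OF y, of j]
          by (auto simp: bars_map_def interval_map_def split: if_splits)
      qed
      moreover have "y \<in> carrier (bars_module B s)"
        using y unfolding carrier_bars_module by (rule subsetD[OF PiE_mono, rotated]) auto
      ultimately show "y \<in> bars_map B s t ` carrier (bars_module B s)"
        by (metis image_eqI)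
    qed
  qed
  moreover have "card (PiE (mset_elems B) ?F) = (\<Prod>j\<in>mset_elems B. card (?F j))"
    by (simp add: card_PiE)
  moreover have "\<dots> = (\<Prod>j\<in>mset_elems B. if alive (fst j) s \<and> alive (fst j) t then 2 else 1)"
  proof (rule prod.cong)
    have UNIV_bit: "(UNIV :: bit set) = {0, 1}" by auto
    have "card (UNIV :: bit set) = 2" by (subst UNIV_bit) simp
    then show "card (?F j) = (if alive (fst j) s \<and> alive (fst j) t then 2 else 1)" for j
      by simp
  qed simp
  moreover have "\<dots> = 2 ^ alive_count B s t"
    by (simp add: alive_count_def flip: prod.inter_filter)
  ultimately show ?thesis by simp
qed

text \<open>By naturality \<open>\<phi> t\<close> carries the image of \<open>p s t\<close> onto
  that of \<open>bars_map\<close>; \<open>cl\<close> places the former where \<open>\<phi> t\<close>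
  is injective.\<close>

lemma card_image_eq_if_pers_iso:
  assumes iso: "pers_iso M p (bars_module B) (bars_map B)"
    and cl: "p s t ` carrier (M s) \<subseteq> carrier (M t)" and "s \<le> t"
  shows "card (p s t ` carrier (M s)) = 2 ^ alive_count B s t"
proof -
  from iso obtain \<phi> where \<phi>: "\<forall>t. \<phi> t \<in> iso (M t) (bars_module B t)"
    and nat: "\<forall>x\<in>carrier (M s). \<phi> t (p s t x) = bars_map B s t (\<phi> s x)"
    using \<open>s \<le> t\<close> unfolding pers_iso_def by blast
  have bij: "bij_betw (\<phi> u) (carrier (M u)) (carrier (bars_module B u))" for u
    using \<phi> by (simp add: iso_def)
  have "\<phi> t ` p s t ` carrier (M s) = bars_map B s t ` \<phi> s ` carrier (M s)"
    using nat by (auto simp: image_image intro!: image_cong)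
  also have "\<dots> = bars_map B s t ` carrier (bars_module B s)"
    using bij by (simp add: bij_betw_def)
  finally have "card (\<phi> t ` p s t ` carrier (M s)) = 2 ^ alive_count B s t"
    by (simp add: card_image_bars_map)
  moreover have "inj_on (\<phi> t) (p s t ` carrier (M s))"
    using bij[of t] cl by (auto simp: bij_betw_def intro: inj_on_subset)
  ultimately show ?thesis by (simp add: card_image)
qed

section \<open>Recovering bars from ranks\<close>

definition bars_from :: "bar multiset \<Rightarrow> real \<Rightarrow> ereal \<Rightarrow> (bar \<times> nat) set" where
  "bars_from B \<beta> \<delta> = {j \<in> mset_elems B. fst (fst j) = \<beta> \<and> \<delta> \<le> snd (fst j)}"

text \<open>Finitely many bars have finitely many endpoints, so some \<open>s\<close> before
  \<open>\<beta>\<close> and \<open>t\<close> before \<open>\<delta>\<close> leave no birth strictly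
  between \<open>s\<close> and \<open>\<beta>\<close> and no death strictly between \<open>t\<close>
  and \<open>\<delta>\<close>. For \<open>\<delta> = \<infinity>\<close> no finite death exceeds
  \<open>t\<close>.\<close>

lemma separating_parameters:
  assumes fin: "finite (F :: bar set)" and "ereal \<beta> < \<delta>"
  obtains s t where "s < \<beta>" "\<beta> \<le> t"
    "\<And>I. I \<in> F \<Longrightarrow> fst I \<le> s \<longleftrightarrow> fst I < \<beta>"
    "\<And>I. I \<in> F \<Longrightarrow> ereal t < snd I \<longleftrightarrow> \<delta> \<le> snd I"
proof -
  \<comment> \<open>The parameters will be \<open>Max L\<close> and \<open>Max R\<close>. The extra
    elements \<open>\<beta> - 1\<close> and \<open>\<beta>\<close> keep both sets nonempty, and the
    latter gives \<open>\<beta> \<le> t\<close>.\<close>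
  define L where "L = insert (\<beta> - 1) (fst ` {I \<in> F. fst I < \<beta>})"
  define R where "R = insert \<beta> ((\<lambda>I. real_of_ereal (snd I)) ` {I \<in> F. ereal \<beta> < snd I \<and> snd I < \<delta>})"
  have finL: "finite L" and finR: "finite R"
    using fin by (simp_all add: L_def R_def)
  have s: "Max L \<in> L" and t: "Max R \<in> R"
    using Max_in[OF finL] Max_in[OF finR] by (auto simp only: L_def R_def)
  have R: "ereal r < \<delta>" if r: "r \<in> R" for r
  proof -
    consider "r = \<beta>" | d where "r = real_of_ereal d" "ereal \<beta> < d" "d < \<delta>"
      using r by (auto simp: R_def)
    then show ?thesis
    proof cases
      case (2 d)
      then show ?thesis by (cases d) auto
    qed (use assms in simp)
  qed
  show ?thesis
  proof
    show "Max L < \<beta>" using s by (auto simp: L_def)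
    show "\<beta> \<le> Max R" using finR by (auto simp: R_def)
  next
    fix I assume I: "I \<in> F"
    show "fst I \<le> Max L \<longleftrightarrow> fst I < \<beta>"
    proof
      assume "fst I \<le> Max L"
      then show "fst I < \<beta>" using s by (auto simp: L_def)
    next
      assume "fst I < \<beta>"
      then show "fst I \<le> Max L" using I by (intro Max_ge[OF finL]) (auto simp: L_def)
    qed
    show "ereal (Max R) < snd I \<longleftrightarrow> \<delta> \<le> snd I"
    proof
      assume "\<delta> \<le> snd I"
      then show "ereal (Max R) < snd I" using R[OF t] by order
    next
      assume less: "ereal (Max R) < snd I"
      show "\<delta> \<le> snd I"
      proof (rule ccontr)
        assume "\<not> \<delta> \<le> snd I"
        moreover have "ereal \<beta> < snd I"
          using less Max_ge[OF finR, of \<beta>] by (cases "snd I") (auto simp: R_def)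
        ultimately have "real_of_ereal (snd I) \<in> R" using I by (force simp: R_def)
        then have "real_of_ereal (snd I) \<le> Max R" using finR by simp
        with less \<open>\<not> \<delta> \<le> snd I\<close> show False by (cases "snd I") auto
      qed
    qed
  qed
qed

text \<open>A bar alive at \<open>\<beta>\<close> and \<open>t\<close> is either alive at
  \<open>s\<close> already or born at \<open>\<beta>\<close>, and outliving \<open>t\<close> amounts
  to dying at \<open>\<delta>\<close> or later. Hence the count of \<open>bars_from\<close> is a
  difference of two ranks.\<close>

lemma alive_count_split:
  assumes "s < \<beta>" "\<beta> \<le> t"
    and "\<And>I. I \<in># B \<Longrightarrow> fst I \<le> s \<longleftrightarrow> fst I < \<beta>"
    and "\<And>I. I \<in># B \<Longrightarrow> ereal t < snd I \<longleftrightarrow> \<delta> \<le> snd I"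
  shows "alive_count B \<beta> t = alive_count B s t + card (bars_from B \<beta> \<delta>)"
proof -
  have mem: "fst j \<in># B" if "j \<in> mset_elems B" for j
    using that by (auto simp: mset_elems_def intro: count_inI)
  have al: "alive I u \<and> alive I t \<longleftrightarrow> fst I \<le> u \<and> \<delta> \<le> snd I"
    if I: "I \<in># B" and u: "u \<le> t" for I u
  proof -
    have "ereal u < snd I" if "ereal t < snd I"
      using u that by (metis ereal_less_eq(3) le_less_trans)
    then show ?thesis using assms(4)[OF I] u by (auto simp: alive_def)
  qed
  have "alive (fst j) \<beta> \<and> alive (fst j) t \<longleftrightarrow>
      alive (fst j) s \<and> alive (fst j) t \<or> fst (fst j) = \<beta> \<and> \<delta> \<le> snd (fst j)"
    if "j \<in> mset_elems B" for j
    using al[OF mem[OF that], of \<beta>] al[OF mem[OF that], of s] assms(1,2) assms(3)[OF mem[OF that]]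
    by auto
  then have "{j \<in> mset_elems B. alive (fst j) \<beta> \<and> alive (fst j) t}
      = {j \<in> mset_elems B. alive (fst j) s \<and> alive (fst j) t} \<union> bars_from B \<beta> \<delta>"
    by (auto simp: bars_from_def)
  moreover have "{j \<in> mset_elems B. alive (fst j) s \<and> alive (fst j) t} \<inter> bars_from B \<beta> \<delta> = {}"
    using assms(1) by (auto simp: bars_from_def alive_def)
  ultimately show ?thesis
    by (simp add: alive_count_def card_Un_disjoint bars_from_def)
qed

lemma card_bars_from_decompose:
  "card (bars_from B \<beta> \<delta>) = count B (\<beta>, \<delta>) +
    card {j \<in> mset_elems B. fst (fst j) = \<beta> \<and> \<delta> < snd (fst j)}"
proof -
  let ?G = "{j \<in> mset_elems B. fst (fst j) = \<beta> \<and> \<delta> < snd (fst j)}"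
  have "bars_from B \<beta> \<delta> = Pair (\<beta>, \<delta>) ` {..<count B (\<beta>, \<delta>)} \<union> ?G"
    by (auto simp: bars_from_def mset_elems_def)
  moreover have "Pair (\<beta>, \<delta>) ` {..<count B (\<beta>, \<delta>)} \<inter> ?G = {}" by auto
  moreover have "card (Pair (\<beta>, \<delta>) ` {..<count B (\<beta>, \<delta>)}) = count B (\<beta>, \<delta>)"
    by (simp add: card_image inj_on_def)
  ultimately show ?thesis
    by (simp add: card_Un_disjoint)
qed

text \<open>Ranks determine every count of \<open>bars_from\<close>, and the multiplicity of a bar
  is the drop of that count from \<open>\<delta>\<close> to the next later death. Properness
  excludes pairs that are never alive and hence invisible to ranks.\<close>

lemma bars_eqI:
  assumes proper: "\<And>I. I \<in># B \<Longrightarrow> ereal (fst I) < snd I"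
      "\<And>I. I \<in># B' \<Longrightarrow> ereal (fst I) < snd I"
    and eq: "\<And>s t. s \<le> t \<Longrightarrow> alive_count B s t = alive_count B' s t"
  shows "B = B'"
proof (rule multiset_eqI)
  have from_eq: "card (bars_from B \<beta> \<delta>) = card (bars_from B' \<beta> \<delta>)" if less: "ereal \<beta> < \<delta>" for \<beta> \<delta>
  proof -
    obtain s t where "s < \<beta>" "\<beta> \<le> t"
      "\<And>I. I \<in> set_mset B \<union> set_mset B' \<Longrightarrow> fst I \<le> s \<longleftrightarrow> fst I < \<beta>"
      "\<And>I. I \<in> set_mset B \<union> set_mset B' \<Longrightarrow> ereal t < snd I \<longleftrightarrow> \<delta> \<le> snd I"
      using separating_parameters[OF _ less, of "set_mset B \<union> set_mset B'"] by auto
    then have "alive_count B \<beta> t = alive_count B s t + card (bars_from B \<beta> \<delta>)"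
      "alive_count B' \<beta> t = alive_count B' s t + card (bars_from B' \<beta> \<delta>)"
      by (intro alive_count_split; simp)+
    then show ?thesis using eq[of \<beta> t] eq[of s t] \<open>s < \<beta>\<close> \<open>\<beta> \<le> t\<close> by simp
  qed
  fix I :: bar
  obtain \<beta> \<delta> where I: "I = (\<beta>, \<delta>)" by fastforce
  show "count B I = count B' I"
  proof (cases "ereal \<beta> < \<delta>")
    case False
    then have "I \<notin># B" "I \<notin># B'" using proper I by fastforce+
    then show ?thesis by (simp add: not_in_iff)
  next
    case True
    let ?G = "\<lambda>B. {j \<in> mset_elems B. fst (fst j) = \<beta> \<and> \<delta> < snd (fst j)}"
    \<comment> \<open>Taking the deaths from both multisets gives one next death \<open>d\<close>
      that serves both.\<close>
    let ?D = "(\<lambda>j. snd (fst j)) ` (?G B \<union> ?G B')"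
    have "card (?G B) = card (?G B')"
    proof (cases "?D = {}")
      case True
      then have "?G B = {}" "?G B' = {}" by simp_all
      then show ?thesis by (simp only:)
    next
      case False
      define d where "d = Min ?D"
      have "d \<in> ?D" unfolding d_def using False by (intro Min_in) simp_all
      then have "\<delta> < d" by auto
      have "d \<le> snd (fst j)" if "j \<in> ?G B \<union> ?G B'" for j
        unfolding d_def using that by (intro Min_le) simp_all
      then have "?G B = bars_from B \<beta> d" "?G B' = bars_from B' \<beta> d"
        using \<open>\<delta> < d\<close> by (auto simp: bars_from_def)
      then show ?thesis using from_eq[of \<beta> d] True \<open>\<delta> < d\<close> by simp
    qed
    then show ?thesis
      using from_eq[OF True] card_bars_from_decompose[of B \<beta> \<delta>] card_bars_from_decompose[of B' \<beta> \<delta>]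
      by (simp add: I)
  qed
qed

text \<open>Uniqueness behind the \<open>THE\<close> in \<open>barcode\<close>: any two candidates
  yield the same image sizes, hence the same ranks.\<close>

lemma barcode_eqI:
  assumes "\<And>I. I \<in># B \<Longrightarrow> ereal (fst I) < snd I"
    and "pers_iso M p (bars_module B) (bars_map B)"
    and cl: "\<And>s t. s \<le> t \<Longrightarrow> p s t ` carrier (M s) \<subseteq> carrier (M t)"
  shows "barcode M p = B"
  unfolding barcode_def
proof (rule the_equality)
  fix B' assume B': "(\<forall>I \<in># B'. ereal (fst I) < snd I) \<and> pers_iso M p (bars_module B') (bars_map B')"
  show "B' = B"
  proof (rule bars_eqI)
    fix s t :: real assume "s \<le> t"
    then have "(2::nat) ^ alive_count B' s t = 2 ^ alive_count B s t"
      using B' assms(2) cl by (metis card_image_eq_if_pers_iso)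
    then show "alive_count B' s t = alive_count B s t" by simp
  qed (use B' assms(1) in auto)
qed (use assms in auto)

text \<open>The matching is done separately for each birth. Matched bars share their birth, so the
  injections for different births have disjoint ranges and combine into one.\<close>

lemma bars_matching:
  assumes "\<And>\<beta> \<delta>. (\<beta>, \<delta>) \<in># B' \<Longrightarrow> card (bars_from B' \<beta> \<delta>) \<le> card (bars_from B \<beta> \<delta>)"
  shows "\<exists>\<phi>. inj_on \<phi> (mset_elems B') \<and> \<phi> ` mset_elems B' \<subseteq> mset_elems B
    \<and> (\<forall>\<beta> \<delta> i. ((\<beta>, \<delta>), i) \<in> mset_elems B' \<longrightarrow>
          (\<exists>\<delta>' j. \<phi> ((\<beta>, \<delta>), i) = ((\<beta>, \<delta>'), j) \<and> \<delta> \<le> \<delta>'))"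
proof -
  define E where "E = (\<lambda>(B :: bar multiset) \<beta>. {j \<in> mset_elems B. fst (fst j) = \<beta>})"
  have "\<exists>f. inj_on f (E B' \<beta>) \<and> f ` E B' \<beta> \<subseteq> E B \<beta>
      \<and> (\<forall>j\<in>E B' \<beta>. snd (fst j) \<le> snd (fst (f j)))" for \<beta>
  proof (rule dominated_matching)
    fix l assume "l \<in> (\<lambda>j. snd (fst j)) ` E B' \<beta>"
    then have "(\<beta>, l) \<in># B'" by (auto simp: E_def mset_elems_def intro: count_inI)
    then show "card {j \<in> E B' \<beta>. l \<le> snd (fst j)} \<le> card {j \<in> E B \<beta>. l \<le> snd (fst j)}"
      using assms by (simp add: E_def bars_from_def conj_assoc)
  qed (simp_all add: E_def)
  then obtain f where f: "\<And>\<beta>. inj_on (f \<beta>) (E B' \<beta>)" "\<And>\<beta>. f \<beta> ` E B' \<beta> \<subseteq> E B \<beta>"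
    "\<And>\<beta> j. j \<in> E B' \<beta> \<Longrightarrow> snd (fst j) \<le> snd (fst (f \<beta> j))"
    by metis
  define \<phi> where "\<phi> = (\<lambda>j. f (fst (fst j)) j)"
  have mem: "j \<in> E B' (fst (fst j))" if "j \<in> mset_elems B'" for j
    using that by (simp add: E_def)
  have \<phi>: "\<phi> j \<in> mset_elems B" "fst (fst (\<phi> j)) = fst (fst j)" "snd (fst j) \<le> snd (fst (\<phi> j))"
    if "j \<in> mset_elems B'" for j
    using f(2)[of "fst (fst j)"] f(3)[OF mem[OF that]] mem[OF that]
    by (auto simp: \<phi>_def E_def)
  have "inj_on \<phi> (mset_elems B')"
  proof (rule inj_onI)
    fix j k assume jk: "j \<in> mset_elems B'" "k \<in> mset_elems B'" "\<phi> j = \<phi> k"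
    then have "fst (fst j) = fst (fst k)" using \<phi>(2) by metis
    then show "j = k"
      using jk mem inj_onD[OF f(1)[of "fst (fst j)"]] by (metis \<phi>_def)
  qed
  moreover have "\<exists>\<delta>' j. \<phi> ((\<beta>, \<delta>), i) = ((\<beta>, \<delta>'), j) \<and> \<delta> \<le> \<delta>'"
    if "((\<beta>, \<delta>), i) \<in> mset_elems B'" for \<beta> \<delta> i
    using \<phi>(2,3)[OF that] by (cases "\<phi> ((\<beta>, \<delta>), i)") auto
  ultimately show ?thesis using \<phi>(1) by blast
qed

section \<open>Quotients of filtered vector spaces\<close>

abbreviation additive_group :: "'c::ab_group_add set \<Rightarrow> 'c monoid" where
  "additive_group A \<equiv> \<lparr>carrier = A, monoid.mult = (+), one = 0\<rparr>"

lemma comm_group_additive: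
  assumes "F2.subspace A"
  shows "comm_group (additive_group A)"
proof (rule comm_groupI)
  fix x assume "x \<in> carrier (additive_group A)"
  then show "\<exists>y\<in>carrier (additive_group A). y \<otimes>\<^bsub>additive_group A\<^esub> x = \<one>\<^bsub>additive_group A\<^esub>"
    by (auto intro!: bexI[of _ x] simp: add_self)
qed (use assms in \<open>auto simp: subspace_iff algebra_simps\<close>)

lemma r_coset_additive: "A #>\<^bsub>additive_group D\<^esub> x = (\<lambda>b. b + x) ` A"
  by (auto simp: r_coset_def)

lemma carrier_quotient:
  "carrier (additive_group D Mod A) = (\<lambda>x. (\<lambda>b. b + x) ` A) ` D"
  by (simp add: carrier_FactGroup r_coset_additive)

text \<open>Holds because \<open>A'\<close> absorbs \<open>A\<close>. For spaces of boundaries it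
  shows that the structure maps merely enlarge cosets.\<close>

lemma translate_into_larger:
  assumes "F2.subspace A" "F2.subspace A'" "A \<subseteq> A'"
  shows "A' <#>\<^bsub>additive_group D\<^esub> ((\<lambda>b. b + x) ` A) = (\<lambda>b. b + x) ` A'"
proof
  show "A' <#>\<^bsub>additive_group D\<^esub> ((\<lambda>b. b + x) ` A) \<subseteq> (\<lambda>b. b + x) ` A'"
    using assms by (force simp: set_mult_def subspace_iff add.assoc[symmetric])
  show "(\<lambda>b. b + x) ` A' \<subseteq> A' <#>\<^bsub>additive_group D\<^esub> ((\<lambda>b. b + x) ` A)"
    using assms by (force simp: set_mult_def subspace_iff)
qed

text \<open>Cycles \<open>Z\<close> and boundaries \<open>B\<close> of a filtration, seen
  abstractly. By \<open>crit\<close> a nonzero vector present at \<open>t\<close> was present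
  already at one of the finitely many critical parameters in \<open>T\<close>. Zero is exempt since
  it lies in every subspace, even before the first critical parameter.\<close>

locale filtered_pair =
  fixes Z B :: "real \<Rightarrow> 'c::boolean_group set" and C :: "'c set" and T :: "real set"
  assumes fin: "finite C" "finite T"
    and C: "F2.subspace C" "\<And>t. Z t \<subseteq> C"
    and sub: "\<And>t. F2.subspace (Z t)" "\<And>t. F2.subspace (B t)"
    and le: "\<And>t. B t \<subseteq> Z t"
    and mono: "\<And>s t. s \<le> t \<Longrightarrow> Z s \<subseteq> Z t" "\<And>s t. s \<le> t \<Longrightarrow> B s \<subseteq> B t"
    and crit: "\<And>x t. x \<in> Z t \<Longrightarrow> x \<noteq> 0 \<Longrightarrow> \<exists>s\<in>T. s \<le> t \<and> x \<in> Z s"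
      "\<And>x t. x \<in> B t \<Longrightarrow> x \<noteq> 0 \<Longrightarrow> \<exists>s\<in>T. s \<le> t \<and> x \<in> B s"
begin

definition Q :: "real \<Rightarrow> 'c set monoid" where
  "Q t = additive_group (Z t) Mod B t"

definition Q_map :: "real \<Rightarrow> real \<Rightarrow> 'c set \<Rightarrow> 'c set" where
  "Q_map s t X = B t <#>\<^bsub>additive_group (Z t)\<^esub> X"

lemma finite_Z: "finite (Z t)"
  using C(2) fin(1) by (rule finite_subset)

lemma carrier_Q: "carrier (Q t) = (\<lambda>x. (\<lambda>b. b + x) ` B t) ` Z t"
  by (simp only: Q_def carrier_quotient)

lemma Q_map_translate: "s \<le> t \<Longrightarrow> Q_map s t ((\<lambda>b. b + x) ` B s) = (\<lambda>b. b + x) ` B t"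
  using sub mono by (simp add: Q_map_def translate_into_larger)

lemma Q_map_image:
  assumes "s \<le> t"
  shows "Q_map s t ` carrier (Q s) = (\<lambda>x. (\<lambda>b. b + x) ` B t) ` Z s"
  using Q_map_translate[OF assms] by (simp add: carrier_Q image_image)

lemma Q_map_closed:
  assumes "s \<le> t"
  shows "Q_map s t ` carrier (Q s) \<subseteq> carrier (Q t)"
  unfolding Q_map_image[OF assms] unfolding carrier_Q by (rule image_mono) (rule mono(1)[OF assms])

text \<open>The first parameter at which \<open>e\<close> is present: by \<open>crit\<close> it
  suffices to look at \<open>T\<close>. The value \<open>\<infinity>\<close> becomes the death of a
  bar that never dies.\<close>

definition entry :: "(real \<Rightarrow> 'c set) \<Rightarrow> 'c \<Rightarrow> ereal" where
  "entry F e = (if \<exists>t. e \<in> F t then ereal (Min {s \<in> T. e \<in> F s}) else \<infinity>)"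

lemma entry_le_iff:
  assumes "e \<noteq> 0" "F = Z \<or> F = B"
  shows "entry F e \<le> ereal t \<longleftrightarrow> e \<in> F t"
proof
  have finT: "finite {s \<in> T. e \<in> F s}" using fin by simp
  have F: "\<exists>s\<in>T. s \<le> u \<and> e \<in> F s" if "e \<in> F u" for u
    using assms crit that by blast
  show "e \<in> F t" if "entry F e \<le> ereal t"
  proof -
    obtain u where "e \<in> F u" using \<open>entry F e \<le> ereal t\<close> by (auto simp: entry_def split: if_splits)
    then have "{s \<in> T. e \<in> F s} \<noteq> {}" using F by blast
    then have "e \<in> F (Min {s \<in> T. e \<in> F s})" using Min_in[OF finT] by blast
    moreover have "Min {s \<in> T. e \<in> F s} \<le> t"
      using that \<open>e \<in> F u\<close> by (auto simp: entry_def split: if_splits)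
    ultimately show ?thesis using mono assms(2) by blast
  qed
  show "entry F e \<le> ereal t" if e: "e \<in> F t"
  proof -
    obtain s where "s \<in> T" "s \<le> t" "e \<in> F s" using F[OF e] by blast
    then have "Min {s \<in> T. e \<in> F s} \<le> t"
      using Min_le[OF finT, of s] by auto
    then show ?thesis using e by (auto simp: entry_def)
  qed
qed

text \<open>The birth is meaningful for vectors occurring in some \<open>Z u\<close>, whose entry is
  finite.\<close>

definition bar_of :: "'c \<Rightarrow> bar" where
  "bar_of e = (real_of_ereal (entry Z e), entry B e)"

lemma alive_bar_of:
  assumes "e \<noteq> 0" "e \<in> Z u"
  shows "alive (bar_of e) t \<longleftrightarrow> e \<in> Z t - B t"
proof -
  have "entry Z e = ereal (real_of_ereal (entry Z e))"
    using assms by (auto simp: entry_def)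
  then have "real_of_ereal (entry Z e) \<le> t \<longleftrightarrow> e \<in> Z t"
    using entry_le_iff[of e Z t] assms by (metis ereal_less_eq(3))
  moreover have "ereal t < entry B e \<longleftrightarrow> e \<notin> B t"
    using entry_le_iff[of e B t] assms by (metis not_le)
  ultimately show ?thesis by (simp add: alive_def bar_of_def)
qed

text \<open>A basis adapted to both filtrations splits the quotient into intervals: a basis vector
  counts from its entry into \<open>Z\<close> until its entry into \<open>B\<close>. Taking
  coordinates on the live bars is a surjection from \<open>Z t\<close> with kernel
  \<open>B t\<close>, so the first isomorphism theorem applies.\<close>

lemma barcode_exists:
  obtains bars where "\<And>I. I \<in># bars \<Longrightarrow> ereal (fst I) < snd I"
    "pers_iso Q Q_map (bars_module bars) (bars_map bars)"
proof -
  obtain S where S: "S \<subseteq> C" "F2.independent S"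
    "adapted S (range Z)" "adapted S (range B)"
  proof (rule adapted_basis_exists[of C "range Z" "range B"])
    show "F2.subspace X \<and> X \<subseteq> C" if "X \<in> range Z \<union> range B" for X
      using that sub C le by blast
    have "Z s \<subseteq> Z t \<or> Z t \<subseteq> Z s" "B s \<subseteq> B t \<or> B t \<subseteq> B s" for s t
      using mono linear[of s t] by blast+
    then show "\<And>X Y. X \<in> range Z \<Longrightarrow> Y \<in> range Z \<Longrightarrow> X \<subseteq> Y \<or> Y \<subseteq> X"
      and "\<And>X Y. X \<in> range B \<Longrightarrow> Y \<in> range B \<Longrightarrow> X \<subseteq> Y \<or> Y \<subseteq> X"
      by blast+
  qed (use fin C in auto)
  let ?rep = "F2.representation S"
  have span_Z: "x \<in> F2.span (S \<inter> Z t)" if "x \<in> Z t" for x t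
    using S(3) that by (auto simp: adapted_def)
  have span_S: "x \<in> F2.span S" if "x \<in> Z t" for x t
    using span_Z[OF that] F2.span_mono[of "S \<inter> Z t" S] by blast
  have rep_Z: "e \<in> S \<inter> Z t" if "x \<in> Z t" "?rep x e \<noteq> 0" for x t e
    using F2.representation_extend[OF S(2) span_Z[OF that(1)]] that(2)
      F2.representation_ne_zero[of "S \<inter> Z t" x e] by auto
  have rep_B: "x \<in> B t \<longleftrightarrow> (\<forall>e. ?rep x e \<noteq> 0 \<longrightarrow> e \<in> B t)" if x: "x \<in> Z t" for x t
  proof
    assume "x \<in> B t"
    then have "x \<in> F2.span (S \<inter> B t)" using S(4) by (auto simp: adapted_def)
    then show "\<forall>e. ?rep x e \<noteq> 0 \<longrightarrow> e \<in> B t"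
      using F2.representation_extend[OF S(2), of x "S \<inter> B t"]
        F2.representation_ne_zero[of "S \<inter> B t" x] by auto
  next
    assume "\<forall>e. ?rep x e \<noteq> 0 \<longrightarrow> e \<in> B t"
    then have "(\<Sum>e | ?rep x e \<noteq> 0. e) \<in> B t"
      by (intro F2.subspace_sum sub) auto
    then show "x \<in> B t" using sum_representation[OF S(2) span_S[OF x]] by simp
  qed
  \<comment> \<open>The remaining basis vectors never represent a nonzero class; their intervals
    would be empty.\<close>
  define R where "R = {e \<in> S. \<exists>t. e \<in> Z t - B t}"
  have finR: "finite R" using S(1) fin(1) by (auto simp: R_def intro: finite_subset)
  have alive_R: "alive (bar_of e) t \<longleftrightarrow> e \<in> Z t - B t" if "e \<in> R" for e t
  proof -
    have "e \<noteq> 0" using that S(2) F2.dependent_zero by (auto simp: R_def)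
    then show ?thesis using alive_bar_of that by (auto simp: R_def)
  qed
  define bars where "bars = image_mset bar_of (mset_set R)"
  let ?J = "mset_elems bars"
  obtain g where g: "bij_betw g ?J R" "\<And>j. j \<in> ?J \<Longrightarrow> bar_of (g j) = fst j"
    using mset_elems_image_mset_bij[OF finR, of bar_of] unfolding bars_def by blast
  have gR: "g j \<in> R" if "j \<in> ?J" for j using g(1) that by (auto simp: bij_betw_def)
  have alive_g: "alive (fst j) t \<longleftrightarrow> g j \<in> Z t - B t" if "j \<in> ?J" for j t
    using alive_R[OF gR[OF that]] g(2)[OF that] by simp
  \<comment> \<open>The vector of a dead bar lies in \<open>B t\<close>, so its coordinate is
    discarded. For an unborn bar the coordinate of a vector of \<open>Z t\<close> is 0
    anyway.\<close>
  define h where "h = (\<lambda>t x. \<lambda>j\<in>?J. if alive (fst j) t then ?rep x (g j) else 0)"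
  have h_add: "h t (x + y) j = h t x j + h t y j"
    if "x \<in> Z t" "y \<in> Z t" "j \<in> ?J" for t x y j
    using that F2.representation_add[OF S(2) span_S span_S] by (auto simp: h_def)
  have h_mult: "h t (x + y) = h t x \<otimes>\<^bsub>bars_module bars t\<^esub> h t y"
    if "x \<in> Z t" "y \<in> Z t" for t x y
  proof
    fix j show "h t (x + y) j = (h t x \<otimes>\<^bsub>bars_module bars t\<^esub> h t y) j"
      using h_add[OF that, of j]
      by (cases "j \<in> ?J") (simp_all add: bars_module_def interval_module_def, simp add: h_def)
  qed
  have h_closed: "h t x \<in> carrier (bars_module bars t)" for t x
    by (auto simp: carrier_bars_module h_def)
  have hom: "group_hom (additive_group (Z t)) (bars_module bars t) (h t)" for t
    using h_mult h_closed comm_group_additive[OF sub(1)] group_bars_module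
    by (auto simp: group_hom_def group_hom_axioms_def hom_def comm_group_def)
  have h_zero: "h t x = \<one>\<^bsub>bars_module bars t\<^esub> \<longleftrightarrow> x \<in> B t" if x: "x \<in> Z t" for t x
  proof -
    have "h t x = \<one>\<^bsub>bars_module bars t\<^esub> \<longleftrightarrow> (\<forall>j\<in>?J. alive (fst j) t \<longrightarrow> ?rep x (g j) = 0)"
      by (auto simp: h_def bars_module_def interval_module_def fun_eq_iff)
    also have "\<dots> \<longleftrightarrow> (\<forall>j\<in>?J. g j \<in> Z t - B t \<longrightarrow> ?rep x (g j) = 0)"
      using alive_g by blast
    also have "\<dots> \<longleftrightarrow> (\<forall>e\<in>R. e \<in> Z t - B t \<longrightarrow> ?rep x e = 0)"
      using g(1) unfolding bij_betw_def by blast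
    also have "\<dots> \<longleftrightarrow> (\<forall>e. ?rep x e \<noteq> 0 \<longrightarrow> e \<in> B t)"
      unfolding R_def using rep_Z[OF x] by blast
    also have "\<dots> \<longleftrightarrow> x \<in> B t" using rep_B[OF x] by simp
    finally show ?thesis .
  qed
  have kernel: "kernel (additive_group (Z t)) (bars_module bars t) (h t) = B t" for t
    using h_zero[of _ t] le[of t] by (auto simp: kernel_def)
  have surj: "h t ` Z t = carrier (bars_module bars t)" for t
  proof
    show "carrier (bars_module bars t) \<subseteq> h t ` Z t"
    proof
      fix y assume y: "y \<in> carrier (bars_module bars t)"
      define A where "A = {j \<in> ?J. y j \<noteq> 0}"
      have gZ: "g j \<in> Z t" if "j \<in> A" for j
        using that y alive_g[of j t] by (auto simp: A_def carrier_bars_module PiE_iff split: if_splits)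
      have gS: "g j \<in> S" if "j \<in> ?J" for j using gR[OF that] by (simp add: R_def)
      \<comment> \<open>Coefficients are bits, so the plain sum of the basis vectors with nonzero
        coordinate is the preimage.\<close>
      define x where "x = (\<Sum>j\<in>A. g j)"
      have "x \<in> Z t" unfolding x_def using gZ by (intro F2.subspace_sum sub) auto
      have rep_x: "?rep x (g k) = y k" if k: "k \<in> ?J" for k
      proof -
        have "?rep x = (\<lambda>e. \<Sum>j\<in>A. ?rep (g j) e)"
          unfolding x_def using gZ span_S by (intro F2.representation_sum[OF S(2)]) blast
        moreover have "?rep (g j) (g k) = (if j = k then 1 else 0)" if "j \<in> A" for j
          using that k g(1) gS F2.representation_basis[OF S(2), of "g j"]
          by (auto simp: A_def bij_betw_def inj_on_def)
        ultimately have "?rep x (g k) = (\<Sum>j\<in>A. if j = k then 1 else 0)" by simp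
        also have "\<dots> = y k" using k by (cases "y k") (auto simp: A_def sum.delta)
        finally show ?thesis .
      qed
      have "y = h t x"
      proof
        fix j show "y j = h t x j"
          using y rep_x[of j]
          by (cases "j \<in> ?J") (auto simp: h_def carrier_bars_module PiE_iff intro: extensional_arb split: if_splits)
      qed
      then show "y \<in> h t ` Z t" using \<open>x \<in> Z t\<close> by (rule image_eqI)
    qed
  qed (use h_closed in auto)
  \<comment> \<open>\<open>h t\<close> is constant on cosets of \<open>B t\<close>, so the image of
    a coset is a singleton.\<close>
  define \<phi> where "\<phi> = (\<lambda>t X. the_elem (h t ` X))"
  have \<phi>_iso: "\<phi> t \<in> iso (Q t) (bars_module bars t)" for t
    using group_hom.FactGroup_iso_set[OF hom, of t] surj[of t] by (simp add: kernel \<phi>_def Q_def)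
  have \<phi>_translate: "\<phi> t ((\<lambda>b. b + x) ` B t) = h t x" if x: "x \<in> Z t" for t x
  proof -
    have "h t (b + x) = h t x" if b: "b \<in> B t" for b
    proof
      fix j
      have "b \<in> Z t" using b le by blast
      moreover have "h t b = \<one>\<^bsub>bars_module bars t\<^esub>" using h_zero[OF \<open>b \<in> Z t\<close>] b by blast
      ultimately show "h t (b + x) j = h t x j"
        using h_add[OF _ x, of b j]
        by (cases "j \<in> ?J") (simp_all add: bars_module_def interval_module_def, simp add: h_def)
    qed
    then have "h t ` (\<lambda>b. b + x) ` B t = {h t x}"
      using F2.subspace_0[OF sub(2)] by (force simp: image_image)
    then show ?thesis by (simp add: \<phi>_def)
  qed
  have \<phi>_natural: "\<phi> t (Q_map s t X) = bars_map bars s t (\<phi> s X)"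
    if st: "s \<le> t" and X: "X \<in> carrier (Q s)" for s t X
  proof -
    obtain x where x: "x \<in> Z s" and X: "X = (\<lambda>b. b + x) ` B s" using X by (auto simp: carrier_Q)
    have xt: "x \<in> Z t" using x mono(1)[OF st] by blast
    have "h t x = bars_map bars s t (h s x)"
    proof
      fix j
      \<comment> \<open>A bar alive at \<open>t\<close> but not at \<open>s\<close> is unborn at
        \<open>s\<close>, since membership in \<open>B s\<close> would persist in
        \<open>B t\<close>. Its vector therefore does not occur in the expansion of
        \<open>x \<in> Z s\<close>.\<close>
      have "?rep x (g j) = 0" if "j \<in> ?J" "alive (fst j) t" "\<not> alive (fst j) s"
        using that alive_g rep_Z[OF x, of "g j"] mono(2)[OF st] by blast
      then show "h t x j = bars_map bars s t (h s x) j"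
        by (auto simp: h_def bars_map_def interval_map_def)
    qed
    then show ?thesis using X x xt by (simp add: Q_map_translate[OF st] \<phi>_translate)
  qed
  have "pers_iso Q Q_map (bars_module bars) (bars_map bars)"
    unfolding pers_iso_def using \<phi>_iso \<phi>_natural by blast
  moreover have "ereal (fst I) < snd I" if I: "I \<in># bars" for I
  proof -
    obtain e where e: "e \<in> R" "I = bar_of e" using I finR by (auto simp: bars_def)
    then obtain t where "e \<in> Z t - B t" by (auto simp: R_def)
    then have "alive I t" using alive_R e by blast
    then show ?thesis by (auto simp: alive_def intro: le_less_trans[of _ "ereal t"])
  qed
  ultimately show ?thesis using that by blast
qed

lemma barcode_Q:
  shows "pers_iso Q Q_map (bars_module (barcode Q Q_map)) (bars_map (barcode Q Q_map))"
    and "\<And>I. I \<in># barcode Q Q_map \<Longrightarrow> ereal (fst I) < snd I"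
proof -
  obtain bars where bars: "\<And>I. I \<in># bars \<Longrightarrow> ereal (fst I) < snd I"
    "pers_iso Q Q_map (bars_module bars) (bars_map bars)"
    using barcode_exists by blast
  then have "barcode Q Q_map = bars" using Q_map_closed by (rule barcode_eqI)
  with bars show "pers_iso Q Q_map (bars_module (barcode Q Q_map)) (bars_map (barcode Q Q_map))"
    and "\<And>I. I \<in># barcode Q Q_map \<Longrightarrow> ereal (fst I) < snd I" by simp_all
qed

lemma alive_count_barcode:
  assumes "s \<le> t"
  shows "2 ^ alive_count (barcode Q Q_map) s t = card ((\<lambda>x. (\<lambda>b. b + x) ` B t) ` Z s)"
  using card_image_eq_if_pers_iso[OF barcode_Q(1) Q_map_closed[OF assms] assms]
  by (simp add: Q_map_image[OF assms])

end

text \<open>Both quotients are covered by \<open>Z s\<close>, so the comparison of ranks reduces to the product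
  formula for the subspaces \<open>Z \<beta> \<inter> B t\<close> and \<open>Z s \<inter> B' t\<close> of \<open>Z \<beta> \<inter> B' t\<close>.\<close>

lemma card_bars_from_quotient_le:
  assumes "filtered_pair Z B C T" "filtered_pair Z' B' C' T'"
    and sub: "\<And>t. Z t \<subseteq> Z' t" "\<And>t. B t \<subseteq> B' t"
    and onto: "\<And>t x. x \<in> Z' t \<Longrightarrow> \<exists>z\<in>Z t. x + z \<in> B' t"
    and less: "ereal \<beta> < \<delta>"
  shows "card (bars_from (barcode (filtered_pair.Q Z' B') (filtered_pair.Q_map Z' B')) \<beta> \<delta>)
    \<le> card (bars_from (barcode (filtered_pair.Q Z B) (filtered_pair.Q_map Z B)) \<beta> \<delta>)"
proof -
  interpret P: filtered_pair Z B C T by fact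
  interpret P': filtered_pair Z' B' C' T' by fact
  let ?b = "barcode P.Q P.Q_map" and ?b' = "barcode P'.Q P'.Q_map"
  obtain s t where st: "s < \<beta>" "\<beta> \<le> t" "s \<le> t"
    and F: "\<And>I. I \<in> set_mset ?b \<union> set_mset ?b' \<Longrightarrow> fst I \<le> s \<longleftrightarrow> fst I < \<beta>"
      "\<And>I. I \<in> set_mset ?b \<union> set_mset ?b' \<Longrightarrow> ereal t < snd I \<longleftrightarrow> \<delta> \<le> snd I"
  proof (rule separating_parameters[OF _ less, of "set_mset ?b \<union> set_mset ?b'"])
    fix s t assume "s < \<beta>" "\<beta> \<le> t"
      "\<And>I. I \<in> set_mset ?b \<union> set_mset ?b' \<Longrightarrow> fst I \<le> s \<longleftrightarrow> fst I < \<beta>"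
      "\<And>I. I \<in> set_mset ?b \<union> set_mset ?b' \<Longrightarrow> ereal t < snd I \<longleftrightarrow> \<delta> \<le> snd I"
    then show thesis using that[of s t] by simp
  qed simp
  define r where "r = (\<lambda>u. card ((\<lambda>x. (\<lambda>b. b + x) ` B t) ` Z u))"
  define r' where "r' = (\<lambda>u. card ((\<lambda>x. (\<lambda>b. b + x) ` B' t) ` Z u))"
  have r: "2 ^ alive_count ?b u t = r u" if "u \<le> t" for u
    using P.alive_count_barcode[OF that] by (simp add: r_def)
  \<comment> \<open>By \<open>onto\<close> every class coming from \<open>Z' u\<close> has a
    representative in \<open>Z u\<close>, so the ranks of both modules are counted over the same
    space.\<close>
  have r': "2 ^ alive_count ?b' u t = r' u" if "u \<le> t" for u
  proof -
    have "(\<lambda>x. (\<lambda>b. b + x) ` B' t) ` Z' u = (\<lambda>x. (\<lambda>b. b + x) ` B' t) ` Z u"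
    proof
      show "(\<lambda>x. (\<lambda>b. b + x) ` B' t) ` Z' u \<subseteq> (\<lambda>x. (\<lambda>b. b + x) ` B' t) ` Z u"
      proof (rule image_subsetI)
        fix x assume "x \<in> Z' u"
        then obtain z where z: "z \<in> Z u" "x + z \<in> B' u" using onto by blast
        then have "(\<lambda>b. b + x) ` B' t = (\<lambda>b. b + z) ` B' t"
          using translate_eq_iff[OF P'.sub(2)] P'.mono(2)[OF that] by blast
        then show "(\<lambda>b. b + x) ` B' t \<in> (\<lambda>x. (\<lambda>b. b + x) ` B' t) ` Z u" using z by blast
      qed
    qed (use sub in blast)
    then show ?thesis using P'.alive_count_barcode[OF that] by (simp add: r'_def)
  qed
  have card_r: "card (Z u) = r u * card (Z u \<inter> B t)" "card (Z u) = r' u * card (Z u \<inter> B' t)" for u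
    unfolding r_def r'_def by (rule card_translates P.sub P'.sub P.finite_Z)+
  have pos: "0 < card (Z u \<inter> B v)" "0 < card (Z u \<inter> B' v)" for u v
    using P.finite_Z F2.subspace_0[OF P.sub(1)] F2.subspace_0[OF P.sub(2)] F2.subspace_0[OF P'.sub(2)]
    by (auto simp: card_gt_0_iff intro!: exI[of _ 0] simp flip: ex_in_conv)
  have Zs: "Z s \<subseteq> Z \<beta>" using P.mono st by simp
  have "card (Z \<beta> \<inter> B t) * card (Z s \<inter> B' t)
      \<le> card (Z \<beta> \<inter> B' t) * card ((Z \<beta> \<inter> B t) \<inter> (Z s \<inter> B' t))"
    using Zs sub(2)[of t] P.finite_Z P.sub P'.sub
    by (intro subspace_card_Int_le F2.subspace_inter) auto
  also have "(Z \<beta> \<inter> B t) \<inter> (Z s \<inter> B' t) = Z s \<inter> B t" using Zs sub by blast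
  finally have "card (Z \<beta> \<inter> B t) * card (Z s \<inter> B' t) \<le> card (Z \<beta> \<inter> B' t) * card (Z s \<inter> B t)" .
  \<comment> \<open>This factor turns the left side into
    \<open>card (Z \<beta>) * card (Z s)\<close>, which \<open>card_r\<close> factors again with the
    other two ranks. Cancelling positive cardinalities then leaves an inequality between
    ranks.\<close>
  then have "(r \<beta> * r' s) * (card (Z \<beta> \<inter> B t) * card (Z s \<inter> B' t))
      \<le> (r \<beta> * r' s) * (card (Z \<beta> \<inter> B' t) * card (Z s \<inter> B t))"
    by (rule mult_le_mono2)
  also have "(r \<beta> * r' s) * (card (Z \<beta> \<inter> B t) * card (Z s \<inter> B' t)) = card (Z \<beta>) * card (Z s)"
    using card_r(1)[of \<beta>] card_r(2)[of s] by simp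
  also have "\<dots> = (r' \<beta> * r s) * (card (Z \<beta> \<inter> B' t) * card (Z s \<inter> B t))"
    using card_r(2)[of \<beta>] card_r(1)[of s] by simp
  finally have "r' \<beta> * r s \<le> r \<beta> * r' s"
    using pos by (simp only: mult_le_cancel2) simp
  then have "(2::nat) ^ (alive_count ?b' \<beta> t + alive_count ?b s t)
      \<le> 2 ^ (alive_count ?b \<beta> t + alive_count ?b' s t)"
    using st by (simp add: power_add r r')
  then have "alive_count ?b' \<beta> t + alive_count ?b s t \<le> alive_count ?b \<beta> t + alive_count ?b' s t"
    by simp
  moreover have "alive_count ?b \<beta> t = alive_count ?b s t + card (bars_from ?b \<beta> \<delta>)"
    using F by (intro alive_count_split st) auto
  moreover have "alive_count ?b' \<beta> t = alive_count ?b' s t + card (bars_from ?b' \<beta> \<delta>)"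
    using F by (intro alive_count_split st) auto
  ultimately show ?thesis by simp
qed

section \<open>Chains and the Vietoris-Rips filtration\<close>

lemma carrier_chain_group:
  "carrier (chain_group k K) = {c. Poly_Mapping.keys c \<subseteq> {\<sigma> \<in> K. card \<sigma> = Suc k}}"
  by (simp add: chain_group_def)

lemma subspace_chain_group: "F2.subspace (carrier (chain_group k K))"
  using keys_add by (force simp: subspace_iff carrier_chain_group)

text \<open>Over Z/2 a chain is determined by its support.\<close>

lemma finite_chain_group:
  assumes "finite K"
  shows "finite (carrier (chain_group k K) :: ('a set \<Rightarrow>\<^sub>0 bit) set)"
proof (rule inj_on_finite)
  show "inj_on Poly_Mapping.keys (carrier (chain_group k K) :: ('a set \<Rightarrow>\<^sub>0 bit) set)"
  proof (rule inj_onI)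
    fix c c' :: "'a set \<Rightarrow>\<^sub>0 bit" assume eq: "Poly_Mapping.keys c = Poly_Mapping.keys c'"
    have "Poly_Mapping.lookup c \<sigma> = Poly_Mapping.lookup c' \<sigma>" for \<sigma>
      using eq in_keys_iff[of \<sigma> c] in_keys_iff[of \<sigma> c'] by (cases "Poly_Mapping.lookup c \<sigma>") auto
    then show "c = c'" by (rule poly_mapping_eqI)
  qed
  show "Poly_Mapping.keys ` carrier (chain_group k K) \<subseteq> Pow K"
    by (auto simp: carrier_chain_group)
qed (use assms in simp)

lemma single_mem_chain_group:
  "\<sigma> \<in> K \<Longrightarrow> card \<sigma> = Suc k \<Longrightarrow> Poly_Mapping.single \<sigma> 1 \<in> carrier (chain_group k K)"
  by (simp add: carrier_chain_group)

definition face_sum :: "'a set \<Rightarrow> ('a set \<Rightarrow>\<^sub>0 bit)" where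
  "face_sum \<sigma> = (if 2 \<le> card \<sigma> then \<Sum>v\<in>\<sigma>. Poly_Mapping.single (\<sigma> - {v}) 1 else 0)"

text \<open>Summing over a fixed set makes additivity visible, whereas the support of a sum may
  shrink by cancellation.\<close>

lemma boundary_eq_sum:
  assumes "finite A" "Poly_Mapping.keys c \<subseteq> A"
  shows "boundary c = (\<Sum>\<sigma>\<in>A. scale2 (Poly_Mapping.lookup c \<sigma>) (face_sum \<sigma>))"
proof -
  have "boundary c = (\<Sum>\<sigma>\<in>Poly_Mapping.keys c. face_sum \<sigma>)"
    unfolding boundary_def face_sum_def by (rule sum.inter_filter) simp
  also have "\<dots> = (\<Sum>\<sigma>\<in>Poly_Mapping.keys c. scale2 (Poly_Mapping.lookup c \<sigma>) (face_sum \<sigma>))"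
    by (rule sum.cong) (auto simp: scale2_def in_keys_iff)
  also have "\<dots> = (\<Sum>\<sigma>\<in>A. scale2 (Poly_Mapping.lookup c \<sigma>) (face_sum \<sigma>))"
    using assms by (intro sum.mono_neutral_left) (auto simp: scale2_def in_keys_iff)
  finally show ?thesis .
qed

lemma boundary_add: "boundary (c + d) = boundary c + boundary d"
proof -
  let ?A = "Poly_Mapping.keys c \<union> Poly_Mapping.keys d"
  have b: "boundary x = (\<Sum>\<sigma>\<in>?A. scale2 (Poly_Mapping.lookup x \<sigma>) (face_sum \<sigma>))" if "x \<in> {c, d, c + d}" for x
    using that keys_add[of c d] by (intro boundary_eq_sum) auto
  show ?thesis
    by (simp only: b insert_iff simp_thms lookup_add F2.scale_left_distrib sum.distrib)
qed

lemma boundary_0 [simp]: "boundary 0 = 0"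
  by (simp add: boundary_def)

lemma boundary_sum: "boundary (\<Sum>i\<in>I. f i) = (\<Sum>i\<in>I. boundary (f i))"
  by (induction I rule: infinite_finite_induct) (simp_all add: boundary_add)

lemma boundary_single: "boundary (Poly_Mapping.single \<sigma> 1) = face_sum \<sigma>"
  using boundary_eq_sum[of "{\<sigma>}" "Poly_Mapping.single \<sigma> 1"] by (simp add: scale2_def)

lemma chain_eq_sum_single:
  "c = (\<Sum>\<sigma>\<in>Poly_Mapping.keys c. Poly_Mapping.single \<sigma> (1 :: bit))"
proof (rule poly_mapping_eqI)
  fix \<tau>
  have "(\<Sum>\<sigma>\<in>Poly_Mapping.keys c. Poly_Mapping.lookup (Poly_Mapping.single \<sigma> (1 :: bit)) \<tau>)
      = (\<Sum>\<sigma>\<in>Poly_Mapping.keys c. if \<sigma> = \<tau> then 1 else 0)"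
    by (rule sum.cong) (auto simp: lookup_single when_def)
  then show "Poly_Mapping.lookup c \<tau> = Poly_Mapping.lookup (\<Sum>\<sigma>\<in>Poly_Mapping.keys c. Poly_Mapping.single \<sigma> 1) \<tau>"
    by (cases "Poly_Mapping.lookup c \<tau>") (auto simp: lookup_sum in_keys_iff sum.delta)
qed

text \<open>In characteristic 2 the terms for \<open>(v, w)\<close> and \<open>(w, v)\<close>
  cancel. The induction splits off the row and the column of one element, which agree by
  symmetry.\<close>

lemma sum_off_diagonal_eq_0:
  fixes g :: "'x \<Rightarrow> 'x \<Rightarrow> 'c::boolean_group"
  assumes "finite A" "\<And>v w. g v w = g w v"
  shows "(\<Sum>v\<in>A. \<Sum>w\<in>A - {v}. g v w) = 0"
  using assms(1)
proof induction
  case (insert a A)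
  have "(\<Sum>v\<in>A. \<Sum>w\<in>insert a A - {v}. g v w) = (\<Sum>v\<in>A. g v a + (\<Sum>w\<in>A - {v}. g v w))"
  proof (rule sum.cong)
    fix v assume "v \<in> A"
    then have "insert a A - {v} = insert a (A - {v})" using insert.hyps by auto
    then show "(\<Sum>w\<in>insert a A - {v}. g v w) = g v a + (\<Sum>w\<in>A - {v}. g v w)"
      using insert.hyps by simp
  qed simp
  also have "\<dots> = (\<Sum>v\<in>A. g a v)"
    using insert.IH assms(2)[of _ a] by (simp add: sum.distrib)
  finally show ?case
    using insert.hyps by (simp add: add_self)
qed simp

text \<open>Removing two vertices in either order leaves the same face, so the double sum is
  symmetric and vanishes.\<close>

lemma boundary_boundary: "boundary (boundary c) = 0"
proof -
  have "boundary (face_sum \<sigma>) = 0" for \<sigma> :: "'a set"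
  proof (cases "3 \<le> card \<sigma>")
    case True
    then have fin: "finite \<sigma>" using card.infinite by force
    have "boundary (face_sum \<sigma>) = (\<Sum>v\<in>\<sigma>. face_sum (\<sigma> - {v}))"
      using True by (simp add: face_sum_def[of \<sigma>] boundary_sum boundary_single)
    also have "\<dots> = (\<Sum>v\<in>\<sigma>. \<Sum>w\<in>\<sigma> - {v}. Poly_Mapping.single (\<sigma> - {v} - {w}) 1)"
      using True fin by (intro sum.cong) (auto simp: face_sum_def)
    also have "\<dots> = 0"
    proof (rule sum_off_diagonal_eq_0[OF fin])
      fix v w
      have "\<sigma> - {v} - {w} = \<sigma> - {w} - {v}" by blast
      then show "Poly_Mapping.single (\<sigma> - {v} - {w}) (1 :: bit) = Poly_Mapping.single (\<sigma> - {w} - {v}) 1"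
        by simp
    qed
    finally show ?thesis .
  next
    case False
    \<comment> \<open>The faces of an edge are vertices, whose boundary is 0 by convention.\<close>
    then have "face_sum (\<sigma> - {v}) = 0" if "v \<in> \<sigma>" for v
      using that by (auto simp: face_sum_def card_Diff_singleton_if)
    then show ?thesis
      using False by (simp add: face_sum_def[of \<sigma>] boundary_sum boundary_single)
  qed
  then show ?thesis
    using boundary_eq_sum[of "Poly_Mapping.keys c" c]
    by (simp add: boundary_sum scale2_def if_distrib[of boundary] cong: if_cong)
qed

lemma boundary_mem_chain_group:
  assumes c: "c \<in> carrier (chain_group (Suc k) K)"
    and faces: "\<And>\<sigma> v. \<sigma> \<in> K \<Longrightarrow> 2 \<le> card \<sigma> \<Longrightarrow> \<sigma> - {v} \<in> K"
  shows "boundary c \<in> carrier (chain_group k K)"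
proof -
  have "face_sum \<sigma> \<in> carrier (chain_group k K)" if \<sigma>: "\<sigma> \<in> Poly_Mapping.keys c" for \<sigma>
  proof -
    have "\<sigma> \<in> K" "card \<sigma> = Suc (Suc k)" using c \<sigma> by (auto simp: carrier_chain_group)
    then show ?thesis
      using faces by (auto simp: face_sum_def intro!: F2.subspace_sum subspace_chain_group single_mem_chain_group)
  qed
  then show ?thesis
    using boundary_eq_sum[of "Poly_Mapping.keys c" c]
    by (auto intro!: F2.subspace_sum F2.subspace_scale subspace_chain_group)
qed

lemma subspace_cycles: "F2.subspace (cycles k K)"
  using subspace_chain_group[of k K] by (auto simp: subspace_iff cycles_def boundary_add)

lemma subspace_boundaries: "F2.subspace (boundaries k K)"
proof -
  have "boundary c + boundary d \<in> boundaries k K"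
    if "c \<in> carrier (chain_group (Suc k) K)" "d \<in> carrier (chain_group (Suc k) K)" for c d
    using that subspace_chain_group[of "Suc k" K]
    by (auto simp: subspace_iff boundaries_def boundary_add[symmetric])
  moreover have "0 \<in> boundaries k K"
    using subspace_chain_group[of "Suc k" K] boundary_0
    by (force simp: subspace_iff boundaries_def)
  ultimately show ?thesis by (auto simp: subspace_iff boundaries_def)
qed

lemma boundaries_subset_cycles:
  assumes "\<And>\<sigma> v. \<sigma> \<in> K \<Longrightarrow> 2 \<le> card \<sigma> \<Longrightarrow> \<sigma> - {v} \<in> K"
  shows "boundaries k K \<subseteq> cycles k K"
  using boundary_mem_chain_group[OF _ assms] by (auto simp: boundaries_def cycles_def boundary_boundary)

lemma chain_group_mono: "K \<subseteq> L \<Longrightarrow> carrier (chain_group k K) \<subseteq> carrier (chain_group k L)"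
  by (auto simp: carrier_chain_group)

lemma cycles_mono: "K \<subseteq> L \<Longrightarrow> cycles k K \<subseteq> cycles k L"
  using chain_group_mono[of K L k] by (auto simp: cycles_def)

lemma boundaries_mono: "K \<subseteq> L \<Longrightarrow> boundaries k K \<subseteq> boundaries k L"
  using chain_group_mono[of K L "Suc k"] by (auto simp: boundaries_def)

lemma cycle_group_eq: "cycle_group k K = additive_group (cycles k K)"
  by (simp add: cycle_group_def chain_group_def)

section \<open>The Rips filtration as a filtered pair\<close>

lemma rips_eq:
  assumes "finite V" "\<And>v. d v v = 0"
  shows "rips V d t = {\<sigma>. \<sigma> \<subseteq> V \<and> \<sigma> \<noteq> {} \<and> (\<forall>v\<in>\<sigma>. \<forall>w\<in>\<sigma>. d v w \<le> t)}"
proof -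
  have "rips_value d \<sigma> \<le> t \<longleftrightarrow> (\<forall>v\<in>\<sigma>. \<forall>w\<in>\<sigma>. d v w \<le> t)" if "\<sigma> \<subseteq> V" "\<sigma> \<noteq> {}" for \<sigma>
  proof (cases "card \<sigma> = 1")
    case True
    \<comment> \<open>The value 0 assigned to vertices agrees with \<open>d v v = 0\<close>, so the
      pairwise condition covers them too.\<close>
    then show ?thesis using assms(2) by (auto simp: rips_value_def card_1_singleton_iff)
  next
    case False
    let ?D = "{d v w | v w. v \<in> \<sigma> \<and> w \<in> \<sigma>}"
    have "?D = (\<lambda>(v, w). d v w) ` (\<sigma> \<times> \<sigma>)" by auto
    then have "finite ?D" "?D \<noteq> {}"
      using that assms(1) finite_subset[of \<sigma> V] by auto
    then have "Max ?D \<le> t \<longleftrightarrow> (\<forall>x\<in>?D. x \<le> t)" by (rule Max_le_iff)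
    then show ?thesis using False by (auto simp: rips_value_def)
  qed
  then show ?thesis by (auto simp: rips_def full_complex_def)
qed

lemma rips_mono: "s \<le> t \<Longrightarrow> rips V d s \<subseteq> rips V d t"
  by (auto simp: rips_def)

text \<open>The support is finite, and at the largest Rips value on it the whole chain is already
  present.\<close>

lemma rips_critical_value:
  assumes "Poly_Mapping.keys c \<subseteq> {\<sigma> \<in> rips V d t. P \<sigma>}" "c \<noteq> 0"
  shows "\<exists>s\<in>rips_value d ` full_complex V. s \<le> t \<and> Poly_Mapping.keys c \<subseteq> {\<sigma> \<in> rips V d s. P \<sigma>}"
proof -
  let ?R = "rips_value d ` Poly_Mapping.keys c"
  have "Poly_Mapping.keys c \<noteq> {}"
    using assms(2) by (metis in_keys_iff empty_iff lookup_zero poly_mapping_eqI)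
  then have "Max ?R \<in> ?R" by (intro Max_in) auto
  then obtain \<tau> where \<tau>: "\<tau> \<in> Poly_Mapping.keys c" "rips_value d \<tau> = Max ?R" by auto
  have "rips_value d \<sigma> \<le> rips_value d \<tau>" if "\<sigma> \<in> Poly_Mapping.keys c" for \<sigma>
    using that \<tau>(2) Max_ge[of ?R "rips_value d \<sigma>"] by auto
  then show ?thesis
    using assms(1) \<tau>(1) by (intro bexI[of _ "rips_value d \<tau>"]) (auto simp: rips_def)
qed

lemma filtered_pair_rips:
  assumes V: "finite V" and d: "\<And>v. d v v = 0"
  shows "filtered_pair (\<lambda>t. cycles k (rips V d t)) (\<lambda>t. boundaries k (rips V d t))
    (carrier (chain_group k (full_complex V))) (rips_value d ` full_complex V)"
proof
  have fin: "finite (full_complex V)"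
    using V by (auto simp: full_complex_def)
  then show "finite (carrier (chain_group k (full_complex V)) :: ('a set \<Rightarrow>\<^sub>0 bit) set)"
    "finite (rips_value d ` full_complex V)"
    by (auto intro: finite_chain_group)
  show "cycles k (rips V d t) \<subseteq> carrier (chain_group k (full_complex V))" for t
    by (auto simp: cycles_def carrier_chain_group rips_def)
  show "boundaries k (rips V d t) \<subseteq> cycles k (rips V d t)" for t
  proof (rule boundaries_subset_cycles)
    fix \<sigma> v assume \<sigma>: "\<sigma> \<in> rips V d t" "2 \<le> card \<sigma>"
    have "\<sigma> - {v} \<noteq> {}"
    proof
      assume "\<sigma> - {v} = {}"
      then have "card \<sigma> \<le> card {v}" by (intro card_mono) auto
      then show False using \<sigma>(2) by simp
    qed
    then show "\<sigma> - {v} \<in> rips V d t" using \<sigma>(1) by (auto simp: rips_eq[of V d, OF V d])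
  qed
  show "\<exists>s\<in>rips_value d ` full_complex V. s \<le> t \<and> x \<in> cycles k (rips V d s)"
    if "x \<in> cycles k (rips V d t)" "x \<noteq> 0" for x t
    using rips_critical_value[of x V d t "\<lambda>\<sigma>. card \<sigma> = Suc k"] that
    by (auto simp: cycles_def carrier_chain_group)
  show "\<exists>s\<in>rips_value d ` full_complex V. s \<le> t \<and> x \<in> boundaries k (rips V d s)"
    if x: "x \<in> boundaries k (rips V d t)" "x \<noteq> 0" for x t
  proof -
    obtain c where c: "Poly_Mapping.keys c \<subseteq> {\<sigma> \<in> rips V d t. card \<sigma> = Suc (Suc k)}" "x = boundary c"
      using x(1) by (auto simp: boundaries_def carrier_chain_group)
    \<comment> \<open>The critical parameter is taken from the bounding chain \<open>c\<close>, not
      from \<open>x\<close>, which may be present as a cycle earlier.\<close>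
    then have "c \<noteq> 0" using x(2) by auto
    then show ?thesis
      using rips_critical_value[OF c(1)] c(2) by (auto simp: boundaries_def carrier_chain_group)
  qed
qed (simp_all add: subspace_chain_group subspace_cycles subspace_boundaries cycles_mono
    boundaries_mono rips_mono)

lemma bcd_eq_barcode_quotient:
  assumes "finite V" "\<And>v. d v v = 0"
  shows "bcd k V d = barcode
    (filtered_pair.Q (\<lambda>t. cycles k (rips V d t)) (\<lambda>t. boundaries k (rips V d t)))
    (filtered_pair.Q_map (\<lambda>t. cycles k (rips V d t)) (\<lambda>t. boundaries k (rips V d t)))"
proof -
  interpret filtered_pair "\<lambda>t. cycles k (rips V d t)" "\<lambda>t. boundaries k (rips V d t)"
    "carrier (chain_group k (full_complex V))" "rips_value d ` full_complex V"
    using assms by (rule filtered_pair_rips)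
  have "Q = (\<lambda>t. homology k (rips V d t))"
    by (simp add: fun_eq_iff Q_def homology_def cycle_group_eq)
  moreover have "Q_map = (\<lambda>s t. homology_inclusion k (rips V d t))"
    by (simp add: fun_eq_iff Q_map_def homology_inclusion_def cycle_group_eq)
  ultimately show ?thesis by (simp add: bcd_def)
qed

section \<open>From weighted paths to chains of edges\<close>

lemma path_edges_snoc:
  "path_edges (p @ [x, y]) = insert {x, y} (path_edges (p @ [x]))"
  by (induction p rule: path_edges.induct) auto

lemma path_edges_rev: "path_edges (rev p) = path_edges p"
  by (induction p rule: path_edges.induct) (simp_all add: path_edges_snoc insert_commute)

lemma is_path_rev: "is_path V E v w p \<Longrightarrow> is_path V E w v (rev p)"
  by (auto simp: is_path_def hd_rev last_rev path_edges_rev)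

lemma finite_path_edges: "finite (path_edges p)"
  by (induction p rule: path_edges.induct) auto

lemma finite_paths: "finite V \<Longrightarrow> finite {p. is_path V E v w p}"
  by (rule finite_subset[OF _ finite_subset_distinct]) (auto simp: is_path_def)

locale connected_weighted_graph =
  fixes V :: "'a set" and E :: "'a set set" and W :: "'a set \<Rightarrow> real"
  assumes graph: "weighted_graph V E W" and conn: "connected_graph V E"
begin

lemma finite_V: "finite V"
  using graph by (simp add: weighted_graph_def)

lemma W_pos: "e \<in> E \<Longrightarrow> 0 < W e"
  using graph by (simp add: weighted_graph_def)

lemma edge_vertices: "{v, w} \<in> E \<Longrightarrow> v \<in> V \<and> w \<in> V \<and> v \<noteq> w"
  using graph by (force simp: weighted_graph_def)

lemma path_weight_mono:
  assumes "path_edges p \<subseteq> path_edges q" "path_edges q \<subseteq> E"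
  shows "path_weight W p \<le> path_weight W q"
  unfolding path_weight_def
  using assms W_pos by (intro sum_mono2 finite_path_edges) (auto intro: less_imp_le)

lemma d_weight_le:
  assumes "is_path V E v w p"
  shows "d_weight V E W v w \<le> path_weight W p"
proof (cases "v = w")
  case True
  then show ?thesis
    using path_weight_mono[of "[]" p] assms by (simp add: d_weight_def is_path_def path_weight_def)
next
  case False
  have "{path_weight W p | p. is_path V E v w p} = path_weight W ` {p. is_path V E v w p}" by auto
  then show ?thesis
    using False assms finite_paths[OF finite_V] by (auto simp: d_weight_def intro!: Min_le)
qed

lemma d_weight_attained:
  assumes "v \<in> V" "w \<in> V" "v \<noteq> w"
  obtains p where "is_path V E v w p" "path_weight W p = d_weight V E W v w"
proof -
  have eq: "{path_weight W p | p. is_path V E v w p} = path_weight W ` {p. is_path V E v w p}" by auto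
  have "{p. is_path V E v w p} \<noteq> {}" using conn assms by (auto simp: connected_graph_def)
  then have "d_weight V E W v w \<in> path_weight W ` {p. is_path V E v w p}"
    using assms finite_paths[OF finite_V]
    by (simp only: d_weight_def eq if_False) (intro Min_in, auto)
  then show ?thesis using that by auto
qed

lemma d_edge_attained:
  assumes "v \<in> V" "w \<in> V" "v \<noteq> w"
  obtains p where "is_path V E v w p" "path_weight W p = d_edge V E W v w"
proof -
  let ?P = "{p. is_path V E v w p}"
  let ?M = "{p. is_path V E v w p \<and> card (path_edges p) = min_edge_count V E v w}"
  have "?P \<noteq> {}" using conn assms by (auto simp: connected_graph_def)
  moreover have "{card (path_edges p) | p. is_path V E v w p} = (\<lambda>p. card (path_edges p)) ` ?P" by auto
  ultimately have "min_edge_count V E v w \<in> (\<lambda>p. card (path_edges p)) ` ?P"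
    using finite_paths[OF finite_V] by (simp only: min_edge_count_def) (intro Min_in, auto)
  then have "?M \<noteq> {}" by auto
  moreover have "finite ?M" using finite_paths[OF finite_V] by (rule rev_finite_subset) auto
  moreover have "{path_weight W p | p. is_path V E v w p \<and> card (path_edges p) = min_edge_count V E v w}
      = path_weight W ` ?M" by auto
  ultimately have "d_edge V E W v w \<in> path_weight W ` ?M"
    using assms by (simp only: d_edge_def if_False) (intro Min_in, auto)
  then show ?thesis using that by auto
qed

lemma d_weight_le_d_edge:
  assumes "v \<in> V" "w \<in> V"
  shows "d_weight V E W v w \<le> d_edge V E W v w"
proof (cases "v = w")
  case False
  then show ?thesis using assms d_edge_attained d_weight_le by metis
qed (simp add: d_weight_def d_edge_def)

text \<open>Between distinct vertices at least one edge is needed, so the edge itself is a path with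
  the minimal number of edges and competes in \<open>d_edge\<close>. Hence edges of weight at most
  \<open>t\<close> with \<open>t \<ge> 0\<close> lie in the Rips complex of
  \<open>d_edge\<close>.\<close>

lemma d_edge_le_weight:
  assumes vw: "{v, w} \<in> E"
  shows "d_edge V E W v w \<le> W {v, w}"
proof -
  have path: "is_path V E v w [v, w]" and "v \<noteq> w"
    using edge_vertices[OF vw] vw by (auto simp: is_path_def)
  let ?P = "{p. is_path V E v w p}"
  have eq: "{card (path_edges p) | p. is_path V E v w p} = (\<lambda>p. card (path_edges p)) ` ?P" by auto
  have pos: "1 \<le> card (path_edges p)" if "is_path V E v w p" for p
    using that \<open>v \<noteq> w\<close> finite_path_edges
    by (cases p rule: path_edges.cases) (auto simp: is_path_def Suc_le_eq card_gt_0_iff)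
  have "min_edge_count V E v w = 1"
    unfolding min_edge_count_def eq
  proof (rule Min_eqI)
    show "1 \<in> (\<lambda>p. card (path_edges p)) ` ?P"
      using path by (intro image_eqI[of _ _ "[v, w]"]) auto
  qed (use pos finite_paths[OF finite_V] in auto)
  then have "[v, w] \<in> {p. is_path V E v w p \<and> card (path_edges p) = min_edge_count V E v w}"
    using path by simp
  moreover have "finite {p. is_path V E v w p \<and> card (path_edges p) = min_edge_count V E v w}"
    using finite_paths[OF finite_V] by (rule rev_finite_subset) auto
  moreover have "{path_weight W p | p. is_path V E v w p \<and> card (path_edges p) = min_edge_count V E v w}
      = path_weight W ` {p. is_path V E v w p \<and> card (path_edges p) = min_edge_count V E v w}" by auto
  ultimately have "d_edge V E W v w \<le> path_weight W [v, w]"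
    using \<open>v \<noteq> w\<close> by (simp only: d_edge_def if_False) (intro Min_le, auto)
  then show ?thesis by (simp add: path_weight_def)
qed

lemma d_weight_self: "d_weight V E W v v = 0"
  by (simp add: d_weight_def)

lemma d_edge_self: "d_edge V E W v v = 0"
  by (simp add: d_edge_def)

lemmas rips_weight_eq = rips_eq[of V "d_weight V E W", OF finite_V d_weight_self]
lemmas rips_edge_eq = rips_eq[of V "d_edge V E W", OF finite_V d_edge_self]

lemma rips_edge_subset: "rips V (d_edge V E W) t \<subseteq> rips V (d_weight V E W) t"
  unfolding rips_weight_eq rips_edge_eq
  using d_weight_le_d_edge by (auto; meson order_trans subsetD)

text \<open>The cone with apex \<open>v\<close> over the path is a union of triangles whose sides are bounded by
  the weight of the whole path.\<close>

lemma edge_homologous_to_path: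
  assumes "is_path V E v w p" "path_weight W p \<le> t" "v \<noteq> w"
  shows "\<exists>q \<in> carrier (chain_group 1 (rips V (d_edge V E W) t)).
    Poly_Mapping.single {v, w} 1 + q \<in> boundaries 1 (rips V (d_weight V E W) t)"
  using assms
proof (induction p arbitrary: v)
  case Nil
  then show ?case by (simp add: is_path_def)
next
  case (Cons a p')
  then obtain x p where p: "a = v" "p' = x # p"
    by (cases p') (auto simp: is_path_def)
  let ?L = "rips V (d_weight V E W) t" and ?K = "rips V (d_edge V E W) t"
  have path: "is_path V E v w (v # x # p)" and wt: "path_weight W (v # x # p) \<le> t"
    using Cons.prems p by auto
  then have vx: "{v, x} \<in> E" and path': "is_path V E x w (x # p)" and pathx: "is_path V E v x [v, x]"
    using edge_vertices by (auto simp: is_path_def)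
  have in_E: "path_edges (v # x # p) \<subseteq> E" using path by (simp add: is_path_def)
  have wt': "path_weight W (x # p) \<le> t" and wtx: "path_weight W [v, x] \<le> t"
    using path_weight_mono[OF _ in_E, of "x # p"] path_weight_mono[OF _ in_E, of "[v, x]"] wt
    by (auto simp: subset_insertI)
  then have Wvx: "W {v, x} \<le> t" by (simp add: path_weight_def)
  have v: "v \<in> V" "x \<in> V" "w \<in> V" "v \<noteq> x" and t: "0 \<le> t"
    using edge_vertices[OF vx] path W_pos[OF vx] Wvx last_in_set[of "v # x # p"]
    by (auto simp: is_path_def)
  \<comment> \<open>The first edge weighs at most as much as the path. Both orders of its ends are
    covered because the Rips condition ranges over ordered pairs.\<close>
  have "{v, x} \<in> ?K"
    using v t Wvx d_edge_le_weight[of v x] d_edge_le_weight[of x v] vx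
    by (auto simp: rips_edge_eq d_edge_self insert_commute)
  then have sx: "Poly_Mapping.single {v, x} 1 \<in> carrier (chain_group 1 ?K)"
    using v by (intro single_mem_chain_group) auto
  show ?case
  proof (cases "x = w")
    case True
    \<comment> \<open>Here the edge is its own replacement, and its double is 0.\<close>
    then have "Poly_Mapping.single {v, w} 1 + Poly_Mapping.single {v, x} 1 \<in> boundaries 1 ?L"
      using F2.subspace_0[OF subspace_boundaries] by (simp add: add_self)
    then show ?thesis using sx by blast
  next
    case False
    obtain q where q: "q \<in> carrier (chain_group 1 ?K)"
      "Poly_Mapping.single {x, w} 1 + q \<in> boundaries 1 ?L"
      using Cons.IH[of x] path' wt' False p by auto
    let ?tri = "{v, x, w}"
    \<comment> \<open>The sides are bounded by the weights of the path, its tail and its first edge,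
      each read in both directions.\<close>
    have "?tri \<in> ?L"
      using v t d_weight_le[OF path] d_weight_le[OF is_path_rev[OF path]] wt
        d_weight_le[OF path'] d_weight_le[OF is_path_rev[OF path']] wt'
        d_weight_le[OF pathx] d_weight_le[OF is_path_rev[OF pathx]] wtx
      by (auto simp: rips_weight_eq d_weight_self path_weight_def path_edges_rev simp del: rev.simps path_edges.simps)
    then have "face_sum ?tri \<in> boundaries 1 ?L"
      using v False Cons.prems(3) single_mem_chain_group[of ?tri ?L 2]
      by (auto simp: boundaries_def numeral_2_eq_2 boundary_single[symmetric])
    \<comment> \<open>The side \<open>{x, w}\<close> occurs twice and cancels modulo 2, which leaves
      \<open>{v, w}\<close>, \<open>{v, x}\<close> and \<open>q\<close>.\<close>
    then have "face_sum ?tri + (Poly_Mapping.single {x, w} 1 + q) \<in> boundaries 1 ?L"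
      using q(2) by (rule F2.subspace_add[OF subspace_boundaries])
    moreover have "face_sum ?tri = Poly_Mapping.single {x, w} 1 +
        (Poly_Mapping.single {v, w} 1 + Poly_Mapping.single {v, x} 1)"
    proof -
      have "?tri - {v} = {x, w}" "?tri - {x} = {v, w}" "?tri - {w} = {v, x}"
        using v False Cons.prems(3) by auto
      then show ?thesis using v False Cons.prems(3) by (simp add: face_sum_def)
    qed
    moreover have "s + (a + b) + (s + q) = a + (b + q)" for s a b :: "'a set \<Rightarrow>\<^sub>0 bit"
    proof -
      have "s + (a + b) + (s + q) = (s + s) + (a + (b + q))" by (simp only: ac_simps)
      then show ?thesis by (simp add: add_self)
    qed
    ultimately have "Poly_Mapping.single {v, w} 1 + (Poly_Mapping.single {v, x} 1 + q) \<in> boundaries 1 ?L"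
      by simp
    moreover have "Poly_Mapping.single {v, x} 1 + q \<in> carrier (chain_group 1 ?K)"
      using sx q(1) by (intro F2.subspace_add subspace_chain_group)
    ultimately show ?thesis by blast
  qed
qed

text \<open>Surjectivity on first homology: every edge of \<open>c\<close> is replaced by a
  homologous chain from the Rips complex of \<open>d_edge\<close>.\<close>

lemma weight_cycle_homologous_to_edge_cycle:
  assumes c: "c \<in> cycles 1 (rips V (d_weight V E W) t)"
  shows "\<exists>z \<in> cycles 1 (rips V (d_edge V E W) t).
    c + z \<in> boundaries 1 (rips V (d_weight V E W) t)"
proof -
  let ?L = "rips V (d_weight V E W) t" and ?K = "rips V (d_edge V E W) t"
  have "\<exists>q \<in> carrier (chain_group 1 ?K). Poly_Mapping.single \<sigma> 1 + q \<in> boundaries 1 ?L"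
    if \<sigma>: "\<sigma> \<in> Poly_Mapping.keys c" for \<sigma>
  proof -
    have "\<sigma> \<in> ?L" "card \<sigma> = 2" using c \<sigma> by (auto simp: cycles_def carrier_chain_group)
    then obtain v w where vw: "\<sigma> = {v, w}" "v \<noteq> w" "v \<in> V" "w \<in> V" "d_weight V E W v w \<le> t"
      by (auto simp: card_2_iff rips_weight_eq)
    then obtain p where "is_path V E v w p" "path_weight W p \<le> t"
      using d_weight_attained[of v w] by metis
    then show ?thesis using edge_homologous_to_path vw by blast
  qed
  then obtain q where q: "\<And>\<sigma>. \<sigma> \<in> Poly_Mapping.keys c \<Longrightarrow> q \<sigma> \<in> carrier (chain_group 1 ?K)"
    "\<And>\<sigma>. \<sigma> \<in> Poly_Mapping.keys c \<Longrightarrow> Poly_Mapping.single \<sigma> 1 + q \<sigma> \<in> boundaries 1 ?L"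
    by metis
  define z where "z = (\<Sum>\<sigma>\<in>Poly_Mapping.keys c. q \<sigma>)"
  have "c + z = (\<Sum>\<sigma>\<in>Poly_Mapping.keys c. Poly_Mapping.single \<sigma> 1 + q \<sigma>)"
    unfolding z_def sum.distrib using chain_eq_sum_single[of c] by simp
  then have cz: "c + z \<in> boundaries 1 ?L"
    using q(2) by (auto intro!: F2.subspace_sum subspace_boundaries)
  \<comment> \<open>\<open>z\<close> differs from the cycle \<open>c\<close> by a boundary, so it is
    a cycle although its summands need not be.\<close>
  then have "boundary (c + z) = 0" by (auto simp: boundaries_def boundary_boundary)
  then have "boundary z = 0" using c by (simp add: boundary_add cycles_def)
  moreover have "z \<in> carrier (chain_group 1 ?K)"
    unfolding z_def using q(1) by (intro F2.subspace_sum subspace_chain_group)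
  ultimately show ?thesis using cz by (auto simp: cycles_def)
qed

end

theorem theorem2p4:
  fixes V :: "'a set" and E :: "'a set set" and W :: "'a set \<Rightarrow> real"
  assumes "weighted_graph V E W" and "connected_graph V E"
  shows "\<exists>\<phi>. inj_on \<phi> (mset_elems (bcd 1 V (d_weight V E W)))
    \<and> \<phi> ` mset_elems (bcd 1 V (d_weight V E W)) \<subseteq> mset_elems (bcd 1 V (d_edge V E W))
    \<and> (\<forall>\<beta> \<delta> i. ((\<beta>, \<delta>), i) \<in> mset_elems (bcd 1 V (d_weight V E W)) \<longrightarrow>
          (\<exists>\<delta>' j. \<phi> ((\<beta>, \<delta>), i) = ((\<beta>, \<delta>'), j) \<and> \<delta> \<le> \<delta>'))"
proof -
  interpret connected_weighted_graph V E W using assms by unfold_locales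
  note pair_weight = filtered_pair_rips[of V "d_weight V E W" 1, OF finite_V d_weight_self]
  note pair_edge = filtered_pair_rips[of V "d_edge V E W" 1, OF finite_V d_edge_self]
  note bcd_weight = bcd_eq_barcode_quotient[of V "d_weight V E W" 1, OF finite_V d_weight_self]
  note bcd_edge = bcd_eq_barcode_quotient[of V "d_edge V E W" 1, OF finite_V d_edge_self]
  show ?thesis
  proof (rule bars_matching)
    \<comment> \<open>Only deaths of actual bars have to be compared. These are proper, which
      provides the strict inequality needed to separate endpoints.\<close>
    fix \<beta> \<delta> assume "(\<beta>, \<delta>) \<in># bcd 1 V (d_weight V E W)"
    then have "ereal \<beta> < \<delta>"
      using filtered_pair.barcode_Q(2)[OF pair_weight, of "(\<beta>, \<delta>)"]
      by (simp only: bcd_weight fst_conv snd_conv)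
    then show "card (bars_from (bcd 1 V (d_weight V E W)) \<beta> \<delta>) \<le> card (bars_from (bcd 1 V (d_edge V E W)) \<beta> \<delta>)"
      unfolding bcd_weight bcd_edge
      using rips_edge_subset weight_cycle_homologous_to_edge_cycle
      by (intro card_bars_from_quotient_le[OF pair_edge pair_weight] cycles_mono boundaries_mono)
  qed
qed

end
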